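(* Let $\Gamma_k(x,\varepsilon)$ be defined by $\Gamma_0(x,\varepsilon)=\gamma(x)$ and $$g(x,\Gamma_{k+1}(x,\varepsilon))=\varepsilon\,\nabla_x\Gamma_k(x,\varepsilon)\,f(x,\Gamma_k(x,\varepsilon)),\qquad k=0,1,2,\dots,$$ and for a solution $(x(t),y(t))$ of $$\frac{dx}{dt}=f(x,y),\qquad\frac{dy}{dt}=\frac1\varepsilon g(x,y),\qquad x(0)=x_0,\ y(0)=y_0,$$ let $z_k(t)=y(t)-\Gamma_k(x(t),\varepsilon)$. Then for any $k=0,1,\dots,K$ and any $A\in(0,2\beta)$ there exists a constant $C_k>0$ such that (for all $t\ge0$) $$|z_k(t)|^2\le C_k\left(\varepsilon^{2k+2}+e^{-\frac A\varepsilon t}|z_k(0)|^2\right),$$ where $C_k$ depends on $k$ and is independent of $\varepsilon$ (it may depend on $A$). In particular, as long as $t$ is sufficiently large, $|z_k(t)|=\mathcal O(\varepsilon^{k+1})$.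
   Context: Setting: $n_x,n_y\ge1$ are integers, $0<\varepsilon\le\varepsilon_0\ll1$, and $f:\mathbb R^{n_x}\times\mathbb R^{n_y}\to\mathbb R^{n_x}$, $g:\mathbb R^{n_x}\times\mathbb R^{n_y}\to\mathbb R^{n_y}$ are sufficiently smooth functions such that, for some fixed integer $K\ge1$, $f\in W^{K,\infty}$ and $\nabla g\in W^{K,\infty}$, where $\|\xi\|_{k,\infty}=\max_{0\le j\le k}\|\nabla^j\xi\|_{L^\infty}$ is the $W^{k,\infty}$ norm. For each $x\in\mathbb R^{n_x}$ there is $\gamma(x)\in\mathbb R^{n_y}$ with $g(x,\gamma(x))=0$, and there is $\beta>0$ with $\langle g(x,y)-g(x,\tilde y),y-\tilde y\rangle\le-\beta|y-\tilde y|^2$ for all $x\in\mathbb R^{n_x}$, $y,\tilde y\in\mathbb R^{n_y}$. Hence for each $x$ the map $g(x,\cdot)$ is a bijection of $\mathbb R^{n_y}$, so $\gamma$ is unique and the iteration defining $\Gamma_{k+1}$ has a unique solution. $\nabla_x\Gamma_k$ denotes the $n_y\times n_x$ Jacobian matrix in $x$. *)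

theory Defs
  imports "HOL-Analysis.Analysis" "HOL-Probability.Essential_Supremum"
begin

definition partial_deriv ::
  "'a::euclidean_space \<Rightarrow> ('a \<Rightarrow> 'b::real_normed_vector) \<Rightarrow> 'a \<Rightarrow> 'b"
  where "partial_deriv b \<xi> = (\<lambda>p. frechet_derivative \<xi> (at p) b)"

text \<open>The entry of the tensor of iterated derivatives with index list \<open>bs\<close>; the
  head of the list is differentiated first. The value is meaningful for functions of
  class \<open>C\<close> to the power \<open>length bs\<close> only.\<close>

primrec iter_partial ::
  "'a::euclidean_space list \<Rightarrow> ('a \<Rightarrow> 'b::real_normed_vector) \<Rightarrow> 'a \<Rightarrow> 'b"
  where
    "iter_partial [] \<xi> = \<xi>"
  | "iter_partial (b # bs) \<xi> = iter_partial bs (partial_deriv b \<xi>)"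

primrec Ck :: "nat \<Rightarrow> ('a::euclidean_space \<Rightarrow> 'b::real_normed_vector) \<Rightarrow> bool"
  where
    "Ck 0 \<xi> \<longleftrightarrow> continuous_on UNIV \<xi>"
  | "Ck (Suc k) \<xi> \<longleftrightarrow>
      (\<forall>p. \<xi> differentiable (at p)) \<and> (\<forall>b\<in>Basis. Ck k (partial_deriv b \<xi>))"

text \<open>The pointwise Euclidean norm of the tensor of all partial derivatives of
  order \<open>j\<close>.\<close>

definition nabla_norm ::
  "nat \<Rightarrow> ('a::euclidean_space \<Rightarrow> 'b::real_normed_vector) \<Rightarrow> 'a \<Rightarrow> real"
  where "nabla_norm j \<xi> p =
    sqrt (\<Sum>bs | set bs \<subseteq> Basis \<and> length bs = j. (norm (iter_partial bs \<xi> p))\<^sup>2)"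

definition Linf_norm :: "('a::euclidean_space \<Rightarrow> real) \<Rightarrow> ennreal"
  where "Linf_norm h = esssup lborel (\<lambda>p. ennreal \<bar>h p\<bar>)"

definition sobolev_inf_norm ::
  "nat \<Rightarrow> ('a::euclidean_space \<Rightarrow> 'b::real_normed_vector) \<Rightarrow> ennreal"
  where "sobolev_inf_norm k \<xi> = Max ((\<lambda>j. Linf_norm (nabla_norm j \<xi>)) ` {0..k})"

text \<open>The norm of the gradient of \<open>\<xi>\<close> in the same space: the derivative tensor of
  order \<open>j\<close> of the gradient is the one of order \<open>j + 1\<close> of \<open>\<xi>\<close>, so \<open>\<xi>\<close> itself need
  not be bounded.\<close>

definition grad_sobolev_inf_norm ::
  "nat \<Rightarrow> ('a::euclidean_space \<Rightarrow> 'b::real_normed_vector) \<Rightarrow> ennreal"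
  where "grad_sobolev_inf_norm k \<xi> = Max ((\<lambda>j. Linf_norm (nabla_norm (Suc j) \<xi>)) ` {0..k})"

definition slow_fast_solution ::
  "('a::real_normed_vector \<times> 'b::real_normed_vector \<Rightarrow> 'a) \<Rightarrow> ('a \<times> 'b \<Rightarrow> 'b) \<Rightarrow> real \<Rightarrow>
    'a \<Rightarrow> 'b \<Rightarrow> (real \<Rightarrow> 'a) \<Rightarrow> (real \<Rightarrow> 'b) \<Rightarrow> bool"
  where "slow_fast_solution f g \<epsilon> x0 y0 x y \<longleftrightarrow>
    x 0 = x0 \<and> y 0 = y0 \<and>
    (\<forall>t\<ge>0. (x has_vector_derivative f (x t, y t)) (at t within {0..})) \<and>
    (\<forall>t\<ge>0. (y has_vector_derivative (1 / \<epsilon>) *\<^sub>R g (x t, y t)) (at t within {0..}))"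

end

theory Submission
  imports Defs
begin

text \<open>
  The deviation \<open>z\<^sub>k = y - \<Gamma>\<^sub>k(x)\<close> satisfies
  \<open>z\<^sub>k' = (g(x, y) - g(x, \<Gamma>\<^sub>k)) / \<epsilon> - R\<^sub>k + D\<Gamma>\<^sub>k (f(x, \<Gamma>\<^sub>k) - f(x, y))\<close>, where the residual is
  \<open>R\<^sub>k = D\<Gamma>\<^sub>k f(x, \<Gamma>\<^sub>k) - D\<Gamma>\<^sub>k\<^sub>-\<^sub>1 f(x, \<Gamma>\<^sub>k\<^sub>-\<^sub>1)\<close>. The first term contracts at rate
  \<open>\<beta> / \<epsilon>\<close> and the last one is \<open>O(|z\<^sub>k|)\<close>, so the claim is a Gronwall estimate once
  \<open>R\<^sub>k = O(\<epsilon> ^ k)\<close> is known. That bound follows by induction on \<open>k\<close>, for all derivatives of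
  \<open>R\<^sub>k\<close> up to order \<open>K - k\<close>: from \<open>g(x, \<Gamma>\<^sub>k\<^sub>+\<^sub>1) - g(x, \<Gamma>\<^sub>k) = \<epsilon> R\<^sub>k\<close> and the monotonicity of
  \<open>g\<close> one gets \<open>\<Gamma>\<^sub>k\<^sub>+\<^sub>1 - \<Gamma>\<^sub>k = O(\<epsilon> ^ (k + 1))\<close> with as many derivatives, and forming
  \<open>R\<^sub>k\<^sub>+\<^sub>1\<close> costs one derivative.
\<close>

subsection \<open>Families of functions with uniformly bounded derivatives\<close>

text \<open>Only the equations are known about the maps \<open>\<Gamma> k\<close>: not even \<gamma>
  is assumed differentiable, and it may be unbounded. Strong monotonicity does what compactness
  would otherwise do: the derivative of \<open>g\<close> in the fast variable is invertible
  everywhere, with inverse of norm at most 1/\<beta>, so the constants are uniform in x and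
  \<epsilon>. For \<open>g\<close> and \<open>\<Gamma> k\<close> only gradients are bounded; values
  enter through \<open>f\<close>, residuals and differences. The orders fit exactly:
  \<open>\<Gamma> k\<close> has bounded derivatives of orders 1 to K - k + 1, the residual up to
  order K - k, so at k = K the plain bound needed for Gronwall is still there. A forcing of size
  \<epsilon>^k against a contraction rate of order 1/\<epsilon> leaves a deviation of size
  \<epsilon>^(k+1). The initial deviation keeps the rate A/\<epsilon>, below the full
  2\<beta>/\<epsilon>; for small \<epsilon> the gap (2\<beta> - A)/\<epsilon> absorbs both the
  forcing and the O(|z|) term.\<close>

text \<open>The index \<open>i\<close> stands for \<open>\<epsilon>\<close>: the weight \<open>w i\<close> carries the power of \<open>\<epsilon>\<close>, and the constant
  must not depend on \<open>i\<close>.\<close>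

definition unif_bdd ::
  "'i set \<Rightarrow> ('i \<Rightarrow> real) \<Rightarrow> ('i \<Rightarrow> 'a \<Rightarrow> 'b::real_normed_vector) \<Rightarrow> bool"
  where "unif_bdd I w u \<longleftrightarrow> (\<exists>C. \<forall>i\<in>I. \<forall>x. norm (u i x) \<le> C * w i)"

text \<open>Total differentiability is demanded at every level below the top, since the chain rule
  needs Frechet derivatives; those of top order are only bounded. Because the recursion passes to
  partial derivatives, closure properties follow by induction on the order, with product and chain
  rules producing functions covered by the induction hypothesis.\<close>

primrec bdd_derivs ::
  "nat \<Rightarrow> 'i set \<Rightarrow> ('i \<Rightarrow> real) \<Rightarrow>
    ('i \<Rightarrow> 'a::euclidean_space \<Rightarrow> 'b::real_normed_vector) \<Rightarrow> bool"
  where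
    "bdd_derivs 0 I w u \<longleftrightarrow> unif_bdd I w u"
  | "bdd_derivs (Suc j) I w u \<longleftrightarrow> unif_bdd I w u \<and>
      (\<forall>i\<in>I. \<forall>x. u i differentiable (at x)) \<and>
      (\<forall>b\<in>Basis. bdd_derivs j I w (\<lambda>i. partial_deriv b (u i)))"

text \<open>Controls the orders 1 to j + 1 and leaves the values free, as needed for
  \<open>g\<close> and for the slow manifolds.\<close>

definition bdd_grad ::
  "nat \<Rightarrow> 'i set \<Rightarrow> ('i \<Rightarrow> real) \<Rightarrow>
    ('i \<Rightarrow> 'a::euclidean_space \<Rightarrow> 'b::real_normed_vector) \<Rightarrow> bool"
  where "bdd_grad j I w u \<longleftrightarrow> (\<forall>i\<in>I. \<forall>x. u i differentiable (at x)) \<and>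
      (\<forall>b\<in>Basis. bdd_derivs j I w (\<lambda>i. partial_deriv b (u i)))"

lemma bdd_derivs_Suc: "bdd_derivs (Suc j) I w u \<longleftrightarrow> unif_bdd I w u \<and> bdd_grad j I w u"
  by (simp add: bdd_grad_def)

lemma partial_deriv_eq: "(u has_derivative D) (at x) \<Longrightarrow> partial_deriv b u x = D b"
  by (metis frechet_derivative_at partial_deriv_def)

lemma unif_bdd_mono:
  assumes "unif_bdd I w v" and "\<And>i x. i \<in> I \<Longrightarrow> norm (u i x) \<le> c * norm (v i x)" and "0 \<le> c"
  shows "unif_bdd I w u"
proof -
  obtain C where C: "\<And>i x. i \<in> I \<Longrightarrow> norm (v i x) \<le> C * w i"
    using assms(1) unfolding unif_bdd_def by blast
  have "norm (u i x) \<le> (c * C) * w i" if "i \<in> I" for i x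
    using assms(2)[OF that, of x] mult_left_mono[OF C[OF that, of x] \<open>0 \<le> c\<close>] by (simp add: mult.assoc)
  then show ?thesis unfolding unif_bdd_def by blast
qed

lemma unif_bdd_add:
  assumes "unif_bdd I w u" "unif_bdd I w v"
  shows "unif_bdd I w (\<lambda>i x. u i x + v i x)"
proof -
  obtain C D where C: "\<And>i x. i \<in> I \<Longrightarrow> norm (u i x) \<le> C * w i"
    and D: "\<And>i x. i \<in> I \<Longrightarrow> norm (v i x) \<le> D * w i"
    using assms unfolding unif_bdd_def by blast
  have "norm (u i x + v i x) \<le> (C + D) * w i" if "i \<in> I" for i x
    using norm_triangle_ineq[of "u i x" "v i x"] C[OF that, of x] D[OF that, of x]
    by (simp add: distrib_right)
  then show ?thesis unfolding unif_bdd_def by blast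
qed

lemma unif_bdd_bilinear:
  assumes "bounded_bilinear p" "unif_bdd I w u" "unif_bdd I w' v"
  shows "unif_bdd I (\<lambda>i. w i * w' i) (\<lambda>i x. p (u i x) (v i x))"
proof -
  obtain C D where C: "\<And>i x. i \<in> I \<Longrightarrow> norm (u i x) \<le> C * w i"
    and D: "\<And>i x. i \<in> I \<Longrightarrow> norm (v i x) \<le> D * w' i"
    using assms unfolding unif_bdd_def by blast
  obtain L where L: "L \<ge> 0" "\<And>a b. norm (p a b) \<le> norm a * norm b * L"
    using bounded_bilinear.nonneg_bounded[OF assms(1)] by blast
  have "norm (p (u i x) (v i x)) \<le> (C * D * L) * (w i * w' i)" if "i \<in> I" for i x
  proof -
    \<comment> \<open>No sign is assumed for \<open>C\<close> or for the weights;
      \<open>C * w i\<close> is nonnegative because it dominates a norm.\<close>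
    have "norm (u i x) * norm (v i x) \<le> (C * w i) * (D * w' i)"
      using C[OF that, of x] D[OF that, of x] order_trans[OF norm_ge_zero C[OF that, of x]]
      by (intro mult_mono) auto
    from mult_right_mono[OF this \<open>L \<ge> 0\<close>] L(2)[of "u i x" "v i x"] show ?thesis
      by (simp add: mult_ac)
  qed
  then show ?thesis unfolding unif_bdd_def by blast
qed

lemma bdd_derivs_unif_bdd: "bdd_derivs j I w u \<Longrightarrow> unif_bdd I w u"
  by (cases j) auto

lemma bdd_derivs_cong:
  assumes "\<And>i x. i \<in> I \<Longrightarrow> u i x = v i x"
  shows "bdd_derivs j I w u \<longleftrightarrow> bdd_derivs j I w v"
  using assms
proof (induction j arbitrary: u v)
  case 0
  then show ?case by (simp add: unif_bdd_def)
next
  case (Suc j)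
  have eq: "u i = v i" if "i \<in> I" for i by (rule ext) (rule Suc.prems[OF that])
  have "bdd_derivs j I w (\<lambda>i. partial_deriv b (u i)) \<longleftrightarrow>
        bdd_derivs j I w (\<lambda>i. partial_deriv b (v i))" for b
    by (rule Suc.IH) (simp add: eq)
  then show ?case by (simp add: eq unif_bdd_def)
qed

lemma bdd_derivs_empty: "bdd_derivs j {} w u"
  by (induction j arbitrary: u) (simp_all add: unif_bdd_def)

text \<open>\<open>partial_deriv\<close> is built from the chosen derivative
  \<open>frechet_derivative\<close>; by uniqueness, any closed form \<open>D\<close> supplied by a
  calculus rule may take its place. The differentiation rules below enter through this
  lemma.\<close>

lemma bdd_gradI:
  assumes "\<And>i x. i \<in> I \<Longrightarrow> (u i has_derivative D i x) (at x)"
    and "\<And>b. b \<in> Basis \<Longrightarrow> bdd_derivs j I w (\<lambda>i x. D i x b)"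
  shows "bdd_grad j I w u"
  unfolding bdd_grad_def
proof (intro conjI ballI allI)
  show "u i differentiable at x" if "i \<in> I" for i x
    using assms(1)[OF that] by (auto simp: differentiable_def)
  show "bdd_derivs j I w (\<lambda>i. partial_deriv b (u i))" if "b \<in> Basis" for b
  proof -
    have "bdd_derivs j I w (\<lambda>i. partial_deriv b (u i)) \<longleftrightarrow> bdd_derivs j I w (\<lambda>i x. D i x b)"
      by (intro bdd_derivs_cong partial_deriv_eq assms(1))
    then show ?thesis using assms(2)[OF that] by simp
  qed
qed

lemma bdd_grad_has_derivative:
  assumes "bdd_grad j I w u" "i \<in> I"
  shows "(u i has_derivative (\<lambda>h. \<Sum>b\<in>Basis. (h \<bullet> b) *\<^sub>R partial_deriv b (u i) x)) (at x)"
proof -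
  let ?D = "frechet_derivative (u i) (at x)"
  have D: "(u i has_derivative ?D) (at x)"
    using assms frechet_derivative_works unfolding bdd_grad_def by blast
  then interpret linear ?D by (rule has_derivative_linear)
  have "?D = (\<lambda>h. \<Sum>b\<in>Basis. (h \<bullet> b) *\<^sub>R partial_deriv b (u i) x)"
  proof
    fix h
    have "?D h = ?D (\<Sum>b\<in>Basis. (h \<bullet> b) *\<^sub>R b)" by (simp add: euclidean_representation)
    then show "?D h = (\<Sum>b\<in>Basis. (h \<bullet> b) *\<^sub>R partial_deriv b (u i) x)"
      by (simp add: sum scale partial_deriv_def)
  qed
  then show ?thesis using D by simp
qed

lemma bdd_derivs_Suc_D: "bdd_derivs (Suc j) I w u \<Longrightarrow> bdd_derivs j I w u"
  by (induction j arbitrary: u) auto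

lemma bdd_derivs_le:
  assumes "bdd_derivs j I w u" "k \<le> j"
  shows "bdd_derivs k I w u"
  using assms(2,1) by (induction rule: dec_induct) (metis bdd_derivs_Suc_D)+

lemma bdd_grad_le: "bdd_grad j I w u \<Longrightarrow> k \<le> j \<Longrightarrow> bdd_grad k I w u"
  unfolding bdd_grad_def using bdd_derivs_le by blast

lemma bdd_grad_partial: "bdd_grad j I w u \<Longrightarrow> b \<in> Basis \<Longrightarrow> bdd_derivs j I w (\<lambda>i. partial_deriv b (u i))"
  by (simp add: bdd_grad_def)

lemma bdd_derivs_zero: "bdd_derivs j I w (\<lambda>i (x :: 'a :: euclidean_space). 0 :: 'b :: real_normed_vector)"
proof (induction j)
  case 0
  show ?case unfolding unif_bdd_def bdd_derivs.simps by (intro exI[of _ 0]) simp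
next
  case (Suc j)
  have "unif_bdd I w (\<lambda>i (x :: 'a). 0 :: 'b)" unfolding unif_bdd_def by (intro exI[of _ 0]) simp
  moreover have "bdd_grad j I w (\<lambda>i (x :: 'a). 0 :: 'b)"
    using Suc by (intro bdd_gradI[OF has_derivative_const])
  ultimately show ?case unfolding bdd_derivs_Suc ..
qed

text \<open>Constant in x but varying with the index: for \<open>c i = i\<close> it supplies the
  factor \<epsilon>, with weight 1 or weight \<epsilon> as needed.\<close>

lemma bdd_derivs_param:
  assumes "\<And>i. i \<in> I \<Longrightarrow> norm (c i) \<le> C * w i"
  shows "bdd_derivs j I w (\<lambda>i (x :: 'a :: euclidean_space). c i)"
proof -
  have u: "unif_bdd I w (\<lambda>i (x :: 'a). c i)" unfolding unif_bdd_def using assms by blast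
  have g: "bdd_grad k I w (\<lambda>i (x :: 'a). c i)" for k
    by (rule bdd_gradI[OF has_derivative_const]) (rule bdd_derivs_zero)
  show ?thesis
  proof (cases j)
    case 0
    then show ?thesis using u by simp
  next
    case (Suc k)
    show ?thesis unfolding Suc bdd_derivs_Suc using u g by blast
  qed
qed

lemma bdd_derivs_add:
  assumes "bdd_derivs j I w u" "bdd_derivs j I w v"
  shows "bdd_derivs j I w (\<lambda>i x. u i x + v i x)"
  using assms
proof (induction j arbitrary: u v)
  case 0
  then show ?case by (simp add: unif_bdd_add)
next
  case (Suc j)
  have "unif_bdd I w (\<lambda>i x. u i x + v i x)"
    using Suc.prems bdd_derivs_unif_bdd unif_bdd_add by blast
  moreover have "bdd_grad j I w (\<lambda>i x. u i x + v i x)"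
  proof (rule bdd_gradI)
    show "((\<lambda>x. u i x + v i x) has_derivative
        (\<lambda>h. frechet_derivative (u i) (at x) h + frechet_derivative (v i) (at x) h)) (at x)"
      if "i \<in> I" for i x
      using Suc.prems that by (intro has_derivative_add frechet_derivative_works[THEN iffD1]) auto
    show "bdd_derivs j I w (\<lambda>i x. frechet_derivative (u i) (at x) b + frechet_derivative (v i) (at x) b)"
      if "b \<in> Basis" for b
      using Suc.IH[of "\<lambda>i. partial_deriv b (u i)" "\<lambda>i. partial_deriv b (v i)"] Suc.prems that
      by (simp add: partial_deriv_def)
  qed
  ultimately show ?case by (simp only: bdd_derivs_Suc)
qed

lemma bdd_derivs_sum:
  assumes "\<And>c. c \<in> S \<Longrightarrow> bdd_derivs j I w (u c)"
  shows "bdd_derivs j I w (\<lambda>i x. \<Sum>c\<in>S. u c i x)"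
proof (cases "finite S")
  case True
  then show ?thesis using assms
    by (induction S) (simp_all add: bdd_derivs_zero bdd_derivs_add)
qed (simp add: bdd_derivs_zero)

text \<open>Weights multiply, which is how a further power of \<epsilon> is gained. In each Leibniz
  term the undifferentiated factor gives up its top order, so the induction hypothesis covers both
  terms.\<close>

lemma bdd_derivs_bilinear:
  assumes "bounded_bilinear p" "bdd_derivs j I w u" "bdd_derivs j I w' v"
  shows "bdd_derivs j I (\<lambda>i. w i * w' i) (\<lambda>i x. p (u i x) (v i x))"
  using assms(2,3)
proof (induction j arbitrary: u v)
  case 0
  then show ?case by (simp add: unif_bdd_bilinear[OF assms(1)])
next
  case (Suc j)
  have "unif_bdd I (\<lambda>i. w i * w' i) (\<lambda>i x. p (u i x) (v i x))"
    by (rule unif_bdd_bilinear[OF assms(1) Suc.prems[THEN bdd_derivs_unif_bdd]])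
  moreover have "bdd_grad j I (\<lambda>i. w i * w' i) (\<lambda>i x. p (u i x) (v i x))"
  proof (rule bdd_gradI)
    show "((\<lambda>x. p (u i x) (v i x)) has_derivative
        (\<lambda>h. p (u i x) (frechet_derivative (v i) (at x) h) +
             p (frechet_derivative (u i) (at x) h) (v i x))) (at x)"
      if "i \<in> I" for i x
      using Suc.prems that
      by (intro bounded_bilinear.FDERIV[OF assms(1)] frechet_derivative_works[THEN iffD1]) auto
    show "bdd_derivs j I (\<lambda>i. w i * w' i) (\<lambda>i x. p (u i x) (frechet_derivative (v i) (at x) b) +
             p (frechet_derivative (u i) (at x) b) (v i x))"
      if "b \<in> Basis" for b
    proof -
      have "bdd_derivs j I w (\<lambda>i x. frechet_derivative (u i) (at x) b)"
        "bdd_derivs j I w' (\<lambda>i x. frechet_derivative (v i) (at x) b)"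
        using Suc.prems that by (simp_all add: partial_deriv_def)
      then show ?thesis
        using Suc.prems[THEN bdd_derivs_Suc_D] by (intro bdd_derivs_add Suc.IH)
    qed
  qed
  ultimately show ?case by (simp only: bdd_derivs_Suc)
qed

lemma unif_bdd_linear:
  assumes "bounded_linear T" "unif_bdd I w u"
  shows "unif_bdd I w (\<lambda>i x. T (u i x))"
proof (rule unif_bdd_mono[OF assms(2)])
  show "norm (T (u i x)) \<le> onorm T * norm (u i x)" for i x
    by (rule onorm[OF assms(1)])
qed (rule onorm_pos_le[OF assms(1)])

lemma bdd_derivs_linear:
  assumes T: "bounded_linear T" and "bdd_derivs j I w u"
  shows "bdd_derivs j I w (\<lambda>i x. T (u i x))"
  using assms(2)
proof (induction j arbitrary: u)
  case 0
  then show ?case using unif_bdd_linear[OF T] by simp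
next
  case (Suc j)
  have "unif_bdd I w (\<lambda>i x. T (u i x))"
    by (rule unif_bdd_linear[OF T bdd_derivs_unif_bdd[OF Suc.prems]])
  moreover have "bdd_grad j I w (\<lambda>i x. T (u i x))"
  proof (rule bdd_gradI)
    show "((\<lambda>x. T (u i x)) has_derivative (\<lambda>h. T (frechet_derivative (u i) (at x) h))) (at x)"
      if "i \<in> I" for i x
      using Suc.prems that
      by (intro bounded_linear.has_derivative[OF T] frechet_derivative_works[THEN iffD1]) auto
    show "bdd_derivs j I w (\<lambda>i x. T (frechet_derivative (u i) (at x) b))" if "b \<in> Basis" for b
      using Suc.IH[of "\<lambda>i. partial_deriv b (u i)"] Suc.prems that by (simp add: partial_deriv_def)
  qed
  ultimately show ?case by (simp only: bdd_derivs_Suc)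
qed

lemma bdd_derivs_minus: "bdd_derivs j I w u \<Longrightarrow> bdd_derivs j I w (\<lambda>i x. - u i x)"
  by (rule bdd_derivs_linear[OF bounded_linear_minus[OF bounded_linear_ident]])

lemma bdd_derivs_diff:
  "bdd_derivs j I w u \<Longrightarrow> bdd_derivs j I w v \<Longrightarrow> bdd_derivs j I w (\<lambda>i x. u i x - v i x)"
  using bdd_derivs_add[OF _ bdd_derivs_minus, of j I w u v] by simp

section \<open>Compositions: chain rule, Lipschitz bounds and differences\<close>

lemma bdd_grad_chain:
  assumes "bdd_grad j I w h" "v i differentiable (at x)" "i \<in> I"
  shows "((\<lambda>x. h i (v i x)) has_derivative (\<lambda>k. \<Sum>c\<in>Basis.
    (frechet_derivative (v i) (at x) k \<bullet> c) *\<^sub>R partial_deriv c (h i) (v i x))) (at x)"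
  using has_derivative_compose[OF frechet_derivative_works[THEN iffD1, OF assms(2)]
      bdd_grad_has_derivative[OF assms(1,3)]] .

lemma bdd_derivs_coord_scaleR:
  assumes "bdd_derivs j I w u" "bdd_derivs j I w' v"
  shows "bdd_derivs j I (\<lambda>i. w i * w' i) (\<lambda>i x. (u i x \<bullet> c) *\<^sub>R v i x)"
  by (rule bdd_derivs_bilinear[OF bounded_bilinear_scaleR
        bdd_derivs_linear[OF bounded_linear_inner_left assms(1)] assms(2)])

text \<open>The inner function is only required to have a bounded gradient, so it need not be bounded
  itself (as for \<open>x \<mapsto> (x, G x)\<close>).\<close>

lemma bdd_derivs_comp_Suc:
  fixes h :: "'i \<Rightarrow> 'b::euclidean_space \<Rightarrow> 'c::real_normed_vector" and v :: "'i \<Rightarrow> 'a::euclidean_space \<Rightarrow> 'b"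
  assumes "bdd_derivs (Suc j) I w h" "bdd_grad j I (\<lambda>_. 1) v"
  shows "bdd_derivs (Suc j) I w (\<lambda>i x. h i (v i x))"
proof -
  \<comment> \<open>The chain rule is isolated here with the composed partial derivatives of
    \<open>h\<close> as a hypothesis. At order 0 these are merely bounded, at higher orders they
    come from the induction hypothesis.\<close>
  have chain: "bdd_derivs (Suc j) I w (\<lambda>i x. h i (v i x))"
    if h: "bdd_derivs (Suc j) I w h" and v: "bdd_grad j I (\<lambda>_. 1) v"
      and c: "\<And>c. c \<in> Basis \<Longrightarrow> bdd_derivs j I w (\<lambda>i x. partial_deriv c (h i) (v i x))"
    for j and h :: "'i \<Rightarrow> 'b \<Rightarrow> 'c"
    unfolding bdd_derivs_Suc
  proof
    show "unif_bdd I w (\<lambda>i x. h i (v i x))"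
      using bdd_derivs_unif_bdd[OF h] unfolding unif_bdd_def by blast
    show "bdd_grad j I w (\<lambda>i x. h i (v i x))"
    proof (rule bdd_gradI)
      show "((\<lambda>x. h i (v i x)) has_derivative (\<lambda>k. \<Sum>c\<in>Basis.
          (frechet_derivative (v i) (at x) k \<bullet> c) *\<^sub>R partial_deriv c (h i) (v i x))) (at x)"
        if "i \<in> I" for i x
        using h v that by (intro bdd_grad_chain[of j I w]) (simp_all add: bdd_grad_def)
      show "bdd_derivs j I w (\<lambda>i x. \<Sum>c\<in>Basis.
          (frechet_derivative (v i) (at x) b \<bullet> c) *\<^sub>R partial_deriv c (h i) (v i x))"
        if "b \<in> Basis" for b
      proof (rule bdd_derivs_sum)
        fix c :: 'b assume "c \<in> Basis"
        with bdd_derivs_coord_scaleR[OF bdd_grad_partial[OF v that] c]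
        show "bdd_derivs j I w (\<lambda>i x.
          (frechet_derivative (v i) (at x) b \<bullet> c) *\<^sub>R partial_deriv c (h i) (v i x))"
          by (simp add: partial_deriv_def)
      qed
    qed
  qed
  show ?thesis using assms
  proof (induction j arbitrary: h)
    case 0
    show ?case
    proof (rule chain[OF 0])
      fix c :: 'b assume "c \<in> Basis"
      then have "unif_bdd I w (\<lambda>i. partial_deriv c (h i))" using 0 by simp
      then show "bdd_derivs 0 I w (\<lambda>i x. partial_deriv c (h i) (v i x))"
        unfolding unif_bdd_def bdd_derivs.simps by blast
    qed
  next
    case (Suc j)
    show ?case
    proof (rule chain[OF Suc.prems])
      fix c :: 'b assume "c \<in> Basis"
      then have "bdd_derivs (Suc j) I w (\<lambda>i. partial_deriv c (h i))"
        using Suc.prems(1) bdd_derivs_Suc bdd_grad_partial by blast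
      then show "bdd_derivs (Suc j) I w (\<lambda>i x. partial_deriv c (h i) (v i x))"
        using Suc.IH bdd_grad_le[OF Suc.prems(2), of j] by simp
    qed
  qed
qed

lemma bdd_derivs_comp:
  assumes "bdd_derivs j I w h" "bdd_grad j I (\<lambda>_. 1) v"
  shows "bdd_derivs j I w (\<lambda>i x. h i (v i x))"
proof (cases j)
  case 0
  with assms(1) show ?thesis unfolding 0 unif_bdd_def bdd_derivs.simps by blast
next
  case (Suc k)
  have v: "bdd_grad k I (\<lambda>_. 1) v" by (rule bdd_grad_le[OF assms(2)]) (simp add: Suc)
  show ?thesis unfolding Suc by (rule bdd_derivs_comp_Suc[OF assms(1)[unfolded Suc] v])
qed

lemma bdd_grad_frechet_bound:
  assumes "bdd_grad j I (\<lambda>_. 1) h"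
  shows "\<exists>L\<ge>0. \<forall>i\<in>I. \<forall>x v. norm (frechet_derivative (h i) (at x) v) \<le> L * norm v"
proof -
  have "\<forall>b\<in>Basis. \<exists>C. \<forall>i\<in>I. \<forall>p. norm (partial_deriv b (h i) p) \<le> C"
    using bdd_grad_partial[OF assms, THEN bdd_derivs_unif_bdd] unfolding unif_bdd_def by simp
  then obtain C where C: "norm (partial_deriv b (h i) p) \<le> C b" if "b \<in> Basis" "i \<in> I" for b i p
    by metis
  have "norm (frechet_derivative (h i) (at x) v) \<le> (\<Sum>b\<in>Basis. \<bar>C b\<bar>) * norm v" if "i \<in> I" for i x v
    unfolding frechet_derivative_at[OF bdd_grad_has_derivative[OF assms that], symmetric] sum_distrib_right
  proof (rule sum_norm_le)
    fix b :: 'b assume b: "b \<in> Basis"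
    have "norm (partial_deriv b (h i) x) \<le> \<bar>C b\<bar>" using C[OF b that, of x] by simp
    then have "\<bar>v \<bullet> b\<bar> * norm (partial_deriv b (h i) x) \<le> norm v * \<bar>C b\<bar>"
      using Basis_le_norm[OF b, of v] by (intro mult_mono) auto
    then show "norm ((v \<bullet> b) *\<^sub>R partial_deriv b (h i) x) \<le> \<bar>C b\<bar> * norm v"
      by (simp add: mult.commute)
  qed
  then show ?thesis by (intro exI[of _ "\<Sum>b\<in>Basis. \<bar>C b\<bar>"]) (simp add: sum_nonneg)
qed

lemma bdd_grad_lipschitz:
  assumes "bdd_grad j I (\<lambda>_. 1) h"
  shows "\<exists>L\<ge>0. \<forall>i\<in>I. \<forall>p q. norm (h i p - h i q) \<le> L * norm (p - q)"
proof -
  obtain L where L: "L \<ge> 0" "\<And>i x v. i \<in> I \<Longrightarrow> norm (frechet_derivative (h i) (at x) v) \<le> L * norm v"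
    using bdd_grad_frechet_bound[OF assms] by blast
  have "norm (h i p - h i q) \<le> L * norm (p - q)" if "i \<in> I" for i p q
  proof (rule differentiable_bound[OF convex_UNIV])
    show "(h i has_derivative frechet_derivative (h i) (at x)) (at x within UNIV)" for x
      using assms that frechet_derivative_works unfolding bdd_grad_def by blast
    show "onorm (frechet_derivative (h i) (at x)) \<le> L" for x
      by (rule onorm_bound[OF L(1) L(2)[OF that]])
  qed simp_all
  with L(1) show ?thesis by blast
qed

text \<open>The size of \<open>v - v'\<close> passes to the difference of the compositions at the
  price of one more derivative of \<open>h\<close>, which is why \<open>h\<close> is measured by
  \<open>bdd_grad j\<close>. At order 0 this is the Lipschitz bound; higher orders apply the
  statement to the partial derivatives of \<open>h\<close>.\<close>

lemma bdd_derivs_comp_diff: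
  fixes h :: "'i \<Rightarrow> 'b::euclidean_space \<Rightarrow> 'c::real_normed_vector"
    and v v' :: "'i \<Rightarrow> 'a::euclidean_space \<Rightarrow> 'b"
  assumes "bdd_grad j I (\<lambda>_. 1) h" "bdd_grad j I (\<lambda>_. 1) v" "bdd_grad j I (\<lambda>_. 1) v'"
    and "bdd_derivs j I w (\<lambda>i x. v i x - v' i x)"
  shows "bdd_derivs j I w (\<lambda>i x. h i (v i x) - h i (v' i x))"
proof -
  have unif: "unif_bdd I w (\<lambda>i x. h i (v i x) - h i (v' i x))"
    if h: "bdd_grad j I (\<lambda>_. 1) h" and "bdd_derivs j I w (\<lambda>i x. v i x - v' i x)"
    for j and h :: "'i \<Rightarrow> 'b \<Rightarrow> 'c"
  proof -
    obtain L where L: "L \<ge> 0" "\<And>i p q. i \<in> I \<Longrightarrow> norm (h i p - h i q) \<le> L * norm (p - q)"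
      using bdd_grad_lipschitz[OF h] by blast
    show ?thesis by (rule unif_bdd_mono[OF bdd_derivs_unif_bdd[OF that(2)] L(2) L(1)])
  qed
  show ?thesis using assms
  proof (induction j arbitrary: h)
    case 0
    then show ?case using unif[of 0 h] by simp
  next
    case (Suc j)
    note D = Suc.prems(4)
    have le: "bdd_grad j I (\<lambda>_. 1) v" "bdd_grad j I (\<lambda>_. 1) v'"
      "bdd_derivs j I w (\<lambda>i x. v i x - v' i x)"
      using Suc.prems(2,3)[THEN bdd_grad_le, of j] bdd_derivs_Suc_D[OF D] by simp_all
    note diffD = Suc.prems(2,3)[unfolded bdd_grad_def, THEN conjunct1, rule_format,
        THEN frechet_derivative_works[THEN iffD1]]
    show ?case unfolding bdd_derivs_Suc
    proof
      show "unif_bdd I w (\<lambda>i x. h i (v i x) - h i (v' i x))"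
        by (rule unif[OF Suc.prems(1,4)])
      show "bdd_grad j I w (\<lambda>i x. h i (v i x) - h i (v' i x))"
      proof (rule bdd_gradI)
        show "((\<lambda>x. h i (v i x) - h i (v' i x)) has_derivative (\<lambda>k.
            (\<Sum>c\<in>Basis. (frechet_derivative (v i) (at x) k \<bullet> c) *\<^sub>R partial_deriv c (h i) (v i x)) -
            (\<Sum>c\<in>Basis. (frechet_derivative (v' i) (at x) k \<bullet> c) *\<^sub>R partial_deriv c (h i) (v' i x)))) (at x)"
          if "i \<in> I" for i x
          using Suc.prems that
          by (intro has_derivative_diff bdd_grad_chain[of "Suc j" I "\<lambda>_. 1"]) (simp_all add: bdd_grad_def)
        fix b :: 'a assume b: "b \<in> Basis"
        \<comment> \<open>Telescoping: Dv times the difference of Dh, plus D(v - v') times Dh at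
          \<open>v'\<close>, so that every summand has exactly one small factor.\<close>
        have split: "(\<Sum>c\<in>Basis. (frechet_derivative (v i) (at x) b \<bullet> c) *\<^sub>R partial_deriv c (h i) (v i x)) -
            (\<Sum>c\<in>Basis. (frechet_derivative (v' i) (at x) b \<bullet> c) *\<^sub>R partial_deriv c (h i) (v' i x)) =
          (\<Sum>c\<in>Basis. (partial_deriv b (v i) x \<bullet> c) *\<^sub>R
              (partial_deriv c (h i) (v i x) - partial_deriv c (h i) (v' i x)) +
            (partial_deriv b (\<lambda>x. v i x - v' i x) x \<bullet> c) *\<^sub>R partial_deriv c (h i) (v' i x))"
          if "i \<in> I" for i x
          unfolding partial_deriv_eq[OF has_derivative_diff[OF diffD[OF that]]] sum_subtractf[symmetric]
          by (rule sum.cong) (simp_all add: partial_deriv_def algebra_simps)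
        have "bdd_derivs j I w (\<lambda>i x. \<Sum>c\<in>Basis. (partial_deriv b (v i) x \<bullet> c) *\<^sub>R
              (partial_deriv c (h i) (v i x) - partial_deriv c (h i) (v' i x)) +
            (partial_deriv b (\<lambda>x. v i x - v' i x) x \<bullet> c) *\<^sub>R partial_deriv c (h i) (v' i x))"
        proof (intro bdd_derivs_sum bdd_derivs_add)
          fix c :: 'b assume c: "c \<in> Basis"
          have hc: "bdd_derivs (Suc j) I (\<lambda>_. 1) (\<lambda>i. partial_deriv c (h i))"
            by (rule bdd_grad_partial[OF Suc.prems(1) c])
          have "bdd_derivs j I w (\<lambda>i x. partial_deriv c (h i) (v i x) - partial_deriv c (h i) (v' i x))"
            using hc by (intro Suc.IH le) (simp add: bdd_grad_def)
          from bdd_derivs_coord_scaleR[OF bdd_grad_partial[OF le(1) b] this]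
          show "bdd_derivs j I w (\<lambda>i x. (partial_deriv b (v i) x \<bullet> c) *\<^sub>R
              (partial_deriv c (h i) (v i x) - partial_deriv c (h i) (v' i x)))" by simp
          have "bdd_derivs j I w (\<lambda>i. partial_deriv b (\<lambda>x. v i x - v' i x))"
            using D b by simp
          from bdd_derivs_coord_scaleR[OF this bdd_derivs_comp[OF bdd_derivs_Suc_D[OF hc] le(2)]]
          show "bdd_derivs j I w (\<lambda>i x. (partial_deriv b (\<lambda>x. v i x - v' i x) x \<bullet> c) *\<^sub>R
              partial_deriv c (h i) (v' i x))" by simp
        qed
        then show "bdd_derivs j I w (\<lambda>i x.
            (\<Sum>c\<in>Basis. (frechet_derivative (v i) (at x) b \<bullet> c) *\<^sub>R partial_deriv c (h i) (v i x)) -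
            (\<Sum>c\<in>Basis. (frechet_derivative (v' i) (at x) b \<bullet> c) *\<^sub>R partial_deriv c (h i) (v' i x)))"
          by (rule bdd_derivs_cong[THEN iffD2, rotated]) (rule split)
      qed
    qed
  qed
qed

section \<open>Derivatives of operator inverses\<close>

text \<open>A Caratheodory form of differentiability: once the increment of \<open>F\<close> factors
  through that of a differentiable \<open>s\<close>, the coefficient \<open>L\<close> needs only
  continuity at x. This permits \<open>L = F\<close>, the case of operator inverses.\<close>

lemma has_derivative_bilinear_increment:
  fixes F :: "'a::real_normed_vector \<Rightarrow> 'b::real_normed_vector"
  assumes p: "bounded_bilinear p" and incr: "\<And>y. F y - F x = p (L y) (s y - s x)"
    and L: "isCont L x" and s: "(s has_derivative s') (at x)"
  shows "(F has_derivative (\<lambda>h. p (L x) (s' h))) (at x)"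
proof -
  interpret p: bounded_bilinear p by (rule p)
  interpret s': bounded_linear s' using s by (rule has_derivative_bounded_linear)
  obtain K where K: "K \<ge> 0" "\<And>a b. norm (p a b) \<le> norm a * norm b * K"
    using p.nonneg_bounded by blast
  let ?e = "\<lambda>y. norm (s y - s x - s' (y - x)) / norm (y - x)"
  show ?thesis unfolding has_derivative_iff_norm
  proof
    show "bounded_linear (\<lambda>h. p (L x) (s' h))"
      by (rule bounded_linear_compose[OF p.bounded_linear_right s'.bounded_linear_axioms])
    show "((\<lambda>y. norm (F y - F x - p (L x) (s' (y - x))) / norm (y - x)) \<longlongrightarrow> 0) (at x)"
    proof (rule tendsto_sandwich[where f = "\<lambda>_. 0"])
      have e: "(?e \<longlongrightarrow> 0) (at x)" using s unfolding has_derivative_iff_norm by blast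
      have "((\<lambda>y. norm (L y)) \<longlongrightarrow> norm (L x)) (at x)" "((\<lambda>y. norm (L y - L x)) \<longlongrightarrow> 0) (at x)"
        using L unfolding isCont_def by (auto intro: tendsto_norm tendsto_norm_zero LIM_zero)
      from tendsto_add[OF tendsto_mult_left_zero[OF tendsto_mult[OF this(1) e, unfolded mult_zero_right]]
          tendsto_mult_left_zero[OF tendsto_mult_left_zero[OF this(2)]]]
      show "((\<lambda>y. norm (L y) * ?e y * K + norm (L y - L x) * onorm s' * K) \<longlongrightarrow> 0) (at x)"
        by simp
      show "\<forall>\<^sub>F y in at x. norm (F y - F x - p (L x) (s' (y - x))) / norm (y - x)
          \<le> norm (L y) * ?e y * K + norm (L y - L x) * onorm s' * K"
        unfolding eventually_at_filter
      proof (intro always_eventually allI impI)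
        fix y assume "y \<noteq> x"
        have "F y - F x - p (L x) (s' (y - x)) = p (L y) (s y - s x - s' (y - x)) + p (L y - L x) (s' (y - x))"
          unfolding incr p.diff_left p.diff_right by simp
        also have "norm \<dots> \<le> norm (L y) * norm (s y - s x - s' (y - x)) * K + norm (L y - L x) * norm (s' (y - x)) * K"
          using K by (intro norm_triangle_mono) auto
        also have "\<dots> \<le> norm (L y) * norm (s y - s x - s' (y - x)) * K + norm (L y - L x) * (onorm s' * norm (y - x)) * K"
          using K(1) onorm[OF s'.bounded_linear_axioms, of "y - x"]
          by (intro add_left_mono mult_right_mono mult_left_mono) auto
        also have "\<dots> = (norm (L y) * ?e y * K + norm (L y - L x) * onorm s' * K) * norm (y - x)"
          using \<open>y \<noteq> x\<close> by (simp add: field_simps)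
        finally show "norm (F y - F x - p (L x) (s' (y - x))) / norm (y - x)
            \<le> norm (L y) * ?e y * K + norm (L y - L x) * onorm s' * K"
          using \<open>y \<noteq> x\<close> by (simp add: pos_divide_le_eq)
      qed
    qed simp_all
  qed
qed

lemma blinfun_compose_assoc: "(a o\<^sub>L b) o\<^sub>L c = a o\<^sub>L (b o\<^sub>L c)"
  by (rule blinfun_eqI) simp

lemma blinfun_compose_id_left: "id_blinfun o\<^sub>L a = a"
  by (rule blinfun_eqI) simp

lemma blinfun_compose_id_right: "a o\<^sub>L id_blinfun = a"
  by (rule blinfun_eqI) simp

text \<open>The identity \<open>N y - N z = N y (M z - M y) N z\<close> gives first the continuity
  of \<open>N\<close>, from its uniform bound, and then the derivative \<open>- N M' N\<close>. As
  that formula contains \<open>N\<close> undifferentiated, each bounded derivative of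
  \<open>M\<close> passes on to \<open>N\<close>.\<close>

lemma bdd_derivs_inverse:
  fixes M N :: "'i \<Rightarrow> 'a::euclidean_space \<Rightarrow> 'b::real_normed_vector \<Rightarrow>\<^sub>L 'b"
  assumes "\<And>i x. i \<in> I \<Longrightarrow> N i x o\<^sub>L M i x = id_blinfun"
    and "\<And>i x. i \<in> I \<Longrightarrow> M i x o\<^sub>L N i x = id_blinfun"
    and bd: "unif_bdd I (\<lambda>_. 1) N" and "bdd_derivs j I (\<lambda>_. 1) M"
  shows "bdd_derivs j I (\<lambda>_. 1) N"
  using assms(4)
proof (induction j)
  case 0
  then show ?case using bd by simp
next
  case (Suc j)
  obtain C where C: "\<And>i x. i \<in> I \<Longrightarrow> norm (N i x) \<le> C"
    using bd unfolding unif_bdd_def by auto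
  show ?case unfolding bdd_derivs_Suc
  proof
    show "bdd_grad j I (\<lambda>_. 1) N"
    proof (rule bdd_gradI)
      fix i x assume i: "i \<in> I"
      have diff: "M i differentiable (at x)" using Suc.prems i by simp
      \<comment> \<open>The shape required by \<open>has_derivative_bilinear_increment\<close>: the
        factor \<open>N i y\<close> has only to be continuous in y, while the differentiable map has
        the second \<open>N\<close> frozen at z.\<close>
      have incr: "N i y - N i z = N i y o\<^sub>L (- (M i y o\<^sub>L N i z) - (- (M i z o\<^sub>L N i z)))" for y z
      proof -
        have "N i y o\<^sub>L (M i y o\<^sub>L N i z) = N i z"
          using assms(1)[OF i, of y] by (metis blinfun_compose_assoc blinfun_compose_id_left)
        then show ?thesis
          by (simp add: assms(2)[OF i] blinfun_compose_id_right bounded_bilinear.diff_right[OF bounded_bilinear_blinfun_compose]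
              bounded_bilinear.minus_right[OF bounded_bilinear_blinfun_compose])
      qed
      have "isCont (N i) x"
      proof -
        have "((\<lambda>y. N i y - N i x) \<longlongrightarrow> 0) (at x)"
        proof (rule Lim_null_comparison)
          show "\<forall>\<^sub>F y in at x. norm (N i y - N i x) \<le> C * norm (- (M i y o\<^sub>L N i x) - (- (M i x o\<^sub>L N i x)))"
          proof (intro always_eventually allI)
            fix y
            show "norm (N i y - N i x) \<le> C * norm (- (M i y o\<^sub>L N i x) - (- (M i x o\<^sub>L N i x)))"
              unfolding incr[of y x]
              by (rule order_trans[OF norm_blinfun_compose]) (intro mult_right_mono C[OF i] norm_ge_zero)
          qed
          have "((M i) \<longlongrightarrow> M i x) (at x)"
            using differentiable_imp_continuous_within[OF diff] by (simp add: continuous_within)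
          then have "((\<lambda>y. M i y o\<^sub>L N i x) \<longlongrightarrow> (M i x o\<^sub>L N i x)) (at x)"
            by (rule bounded_linear.tendsto[OF
                bounded_bilinear.bounded_linear_left[OF bounded_bilinear_blinfun_compose]])
          from tendsto_mult_right_zero[OF tendsto_norm_zero[OF LIM_zero[OF tendsto_minus[OF this]]]]
          show "((\<lambda>y. C * norm (- (M i y o\<^sub>L N i x) - (- (M i x o\<^sub>L N i x)))) \<longlongrightarrow> 0) (at x)" .
        qed
        then show ?thesis unfolding isCont_def by (rule LIM_zero_cancel)
      qed
      moreover have "((\<lambda>y. - (M i y o\<^sub>L N i x)) has_derivative
          (\<lambda>h. - (frechet_derivative (M i) (at x) h o\<^sub>L N i x))) (at x)"
        by (intro has_derivative_minus bounded_linear.has_derivative[OF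
            bounded_bilinear.bounded_linear_left[OF bounded_bilinear_blinfun_compose]]
            frechet_derivative_works[THEN iffD1, OF diff])
      ultimately show "(N i has_derivative (\<lambda>h. N i x o\<^sub>L - (frechet_derivative (M i) (at x) h o\<^sub>L N i x))) (at x)"
        by (rule has_derivative_bilinear_increment[OF bounded_bilinear_blinfun_compose,
              where L = "N i" and s = "\<lambda>y. - (M i y o\<^sub>L N i x)", OF incr])
    next
      fix b :: 'a assume b: "b \<in> Basis"
      have M: "bdd_derivs j I (\<lambda>_. 1) (\<lambda>i x. frechet_derivative (M i) (at x) b)"
        using Suc.prems b by (simp add: partial_deriv_def)
      have N: "bdd_derivs j I (\<lambda>_. 1) N" by (rule Suc.IH[OF bdd_derivs_Suc_D[OF Suc.prems]])
      have "bdd_derivs j I (\<lambda>i. 1 * 1) (\<lambda>i x. frechet_derivative (M i) (at x) b o\<^sub>L N i x)"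
        by (rule bdd_derivs_bilinear[OF bounded_bilinear_blinfun_compose M N])
      from bdd_derivs_bilinear[OF bounded_bilinear_blinfun_compose N bdd_derivs_minus[OF this]]
      show "bdd_derivs j I (\<lambda>_. 1) (\<lambda>i x. N i x o\<^sub>L - (frechet_derivative (M i) (at x) b o\<^sub>L N i x))"
        by simp
    qed
  qed (rule bd)
qed

subsection \<open>Implicit functions of a strongly monotone map\<close>

text \<open>The partial derivative of \<open>g\<close> in the fast variable, as an operator assembled from the
  coordinate derivatives so that bounds on the latter carry over.\<close>

definition fast_jac :: "('a::euclidean_space \<times> 'b::euclidean_space \<Rightarrow> 'b) \<Rightarrow> 'a \<times> 'b \<Rightarrow> 'b \<Rightarrow>\<^sub>L 'b"
  where "fast_jac g p =
    (\<Sum>c\<in>Basis. blinfun_scaleR_left (partial_deriv (0, c) g p) o\<^sub>L blinfun_inner_right c)"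

lemma fast_jac_apply:
  assumes "(g has_derivative g') (at p)"
  shows "blinfun_apply (fast_jac g p) v = g' (0, v)"
proof -
  interpret g': linear g' using assms by (rule has_derivative_linear)
  have "g' (0, v) = g' (0, \<Sum>c\<in>Basis. (v \<bullet> c) *\<^sub>R c)" by (simp only: euclidean_representation)
  also have "(0, \<Sum>c\<in>Basis. (v \<bullet> c) *\<^sub>R c) = (\<Sum>c\<in>Basis. (v \<bullet> c) *\<^sub>R (0, c))"
    by (simp add: prod_eq_iff fst_sum snd_sum)
  also have "g' \<dots> = (\<Sum>c\<in>Basis. (v \<bullet> c) *\<^sub>R g' (0, c))" by (simp only: g'.sum g'.scale)
  finally show ?thesis
    by (simp add: fast_jac_def blinfun.sum_left partial_deriv_eq[OF assms] inner_commute)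
qed

lemma bounded_linear_rank_one:
  "bounded_linear (\<lambda>a. blinfun_scaleR_left a o\<^sub>L blinfun_inner_right c)"
  by (rule bounded_linear_compose[OF
        bounded_bilinear.bounded_linear_left[OF bounded_bilinear_blinfun_compose]
        bounded_linear_blinfun_scaleR_left])

lemma bdd_derivs_fast_jac:
  fixes u :: "'i \<Rightarrow> 'd::euclidean_space \<Rightarrow> 'a::euclidean_space \<times> 'b::euclidean_space"
  assumes "\<And>c. c \<in> Basis \<Longrightarrow> bdd_derivs j I w (\<lambda>i x. partial_deriv c g (u i x))"
  shows "bdd_derivs j I w (\<lambda>i x. fast_jac g (u i x))"
  unfolding fast_jac_def
proof (rule bdd_derivs_sum)
  fix c :: 'b assume "c \<in> Basis"
  then have "bdd_derivs j I w (\<lambda>i x. partial_deriv (0, c) g (u i x))"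
    by (intro assms) (simp add: Basis_prod_def)
  from bdd_derivs_linear[OF bounded_linear_rank_one this]
  show "bdd_derivs j I w (\<lambda>i x. blinfun_scaleR_left (partial_deriv (0, c) g (u i x)) o\<^sub>L blinfun_inner_right c)" .
qed

lemma bdd_derivs_fast_jac_diff:
  fixes u u' :: "'i \<Rightarrow> 'd::euclidean_space \<Rightarrow> 'a::euclidean_space \<times> 'b::euclidean_space"
  assumes "\<And>c. c \<in> Basis \<Longrightarrow>
    bdd_derivs j I w (\<lambda>i x. partial_deriv c g (u i x) - partial_deriv c g (u' i x))"
  shows "bdd_derivs j I w (\<lambda>i x. fast_jac g (u i x) - fast_jac g (u' i x))"
  unfolding fast_jac_def sum_subtractf[symmetric]
proof (rule bdd_derivs_sum)
  fix c :: 'b assume "c \<in> Basis"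
  then have "bdd_derivs j I w (\<lambda>i x. partial_deriv (0, c) g (u i x) - partial_deriv (0, c) g (u' i x))"
    by (intro assms) (simp add: Basis_prod_def)
  from bdd_derivs_linear[OF bounded_linear_rank_one this]
  show "bdd_derivs j I w (\<lambda>i x. (blinfun_scaleR_left (partial_deriv (0, c) g (u i x)) o\<^sub>L blinfun_inner_right c) -
      (blinfun_scaleR_left (partial_deriv (0, c) g (u' i x)) o\<^sub>L blinfun_inner_right c))"
    unfolding linear_diff[OF bounded_linear.linear[OF bounded_linear_rank_one]] .
qed

text \<open>Cauchy-Schwarz turns coercivity into \<open>\<beta> * norm v \<le> norm (M v)\<close>.
  This gives injectivity, hence invertibility in finite dimension, and a bound on the inverse that
  depends on \<beta> alone.\<close>

lemma coercive_inverse: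
  fixes M :: "'b::euclidean_space \<Rightarrow>\<^sub>L 'b"
  assumes "0 < \<beta>" and coercive: "\<And>v. blinfun_apply M v \<bullet> v \<le> - \<beta> * (norm v)\<^sup>2"
  shows "\<exists>N. N o\<^sub>L M = id_blinfun \<and> M o\<^sub>L N = id_blinfun \<and> norm N \<le> 1 / \<beta>"
proof -
  have bound: "\<beta> * norm v \<le> norm (blinfun_apply M v)" for v
  proof (cases "v = 0")
    case False
    have "\<beta> * norm v * norm v \<le> - (blinfun_apply M v \<bullet> v)"
      using coercive[of v] by (simp add: power2_eq_square)
    also have "\<dots> \<le> norm (blinfun_apply M v) * norm v"
      using Cauchy_Schwarz_ineq2[of "blinfun_apply M v" v] by linarith
    finally show ?thesis using False by simp
  qed simp
  have lin: "linear (blinfun_apply M)" by (simp add: blinfun.bounded_linear_right bounded_linear.linear)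
  have "inj (blinfun_apply M)"
    unfolding linear_injective_0[OF lin]
  proof (intro allI impI)
    fix v assume "blinfun_apply M v = 0"
    then show "v = 0" using bound[of v] \<open>0 < \<beta>\<close> by (simp add: mult_le_0_iff)
  qed
  then obtain n where n: "linear n" "\<And>v. n (blinfun_apply M v) = v" "\<And>v. blinfun_apply M (n v) = v"
    using linear_injective_isomorphism[OF lin] by blast
  have N: "blinfun_apply (Blinfun n) = n"
    using n(1) by (simp add: bounded_linear_Blinfun_apply linear_conv_bounded_linear)
  have "norm (Blinfun n) \<le> 1 / \<beta>"
  proof (rule norm_blinfun_bound)
    show "norm (blinfun_apply (Blinfun n) v) \<le> 1 / \<beta> * norm v" for v
      using bound[of "n v"] \<open>0 < \<beta>\<close> by (simp add: N n(3) field_simps)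
  qed (use \<open>0 < \<beta>\<close> in simp)
  then show ?thesis by (intro exI[of _ "Blinfun n"]) (auto intro!: blinfun_eqI simp: N n)
qed

text \<open>The solution \<open>G\<close> is given and Lipschitz at x, so no implicit function
  theorem is invoked: linearise \<open>g (y, G y) = r y\<close> at x, control the error of
  \<open>g\<close> by the Lipschitz bound, and solve for the increment of \<open>G\<close> with
  \<open>N\<close>.\<close>

lemma implicit_has_derivative:
  fixes g :: "'a::euclidean_space \<times> 'b::euclidean_space \<Rightarrow> 'b"
  assumes g': "(g has_derivative g') (at (x, G x))" and r': "(r has_derivative r') (at x)"
    and G: "\<And>y. g (y, G y) = r y" and lip: "\<And>y. norm (G y - G x) \<le> L * norm (y - x)" "L \<ge> 0"
    and N: "bounded_linear N" "\<And>v. N (g' (0, v)) = v"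
  shows "(G has_derivative (\<lambda>h. N (r' h - g' (h, 0)))) (at x)"
proof -
  interpret g': bounded_linear g' using g' by (rule has_derivative_bounded_linear)
  interpret r': bounded_linear r' using r' by (rule has_derivative_bounded_linear)
  interpret N: bounded_linear N by (rule N)
  obtain C where C: "C > 0" "\<And>v. norm (N v) \<le> norm v * C" using N.pos_bounded by blast
  show ?thesis unfolding has_derivative_within_alt
  proof (intro conjI allI impI)
    have "bounded_linear (\<lambda>h. g' (h, 0))"
      by (rule bounded_linear_compose[OF g'.bounded_linear_axioms
            bounded_linear_Pair[OF bounded_linear_ident bounded_linear_zero]])
    from bounded_linear_compose[OF N(1) bounded_linear_sub[OF r'.bounded_linear_axioms this]]
    show "bounded_linear (\<lambda>h. N (r' h - g' (h, 0)))" .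
    fix e :: real assume "0 < e"
    \<comment> \<open>Error budget for an increment k of x: \<open>r\<close> contributes \<eta>|k|,
      \<open>g\<close> contributes \<eta>(1 + L)|k| because the joint increment has norm at most (1
      + L)|k|, and \<open>N\<close> multiplies by at most \<open>C\<close>. The total is then
      e|k|.\<close>
    define \<eta> where "\<eta> = e / (C * (2 + L))"
    have pos: "0 < C * (2 + L)" using C(1) \<open>L \<ge> 0\<close> by simp
    have "C * (\<eta> + \<eta> * (1 + L)) = C * (2 + L) * \<eta>" by (simp add: algebra_simps)
    also have "\<dots> = e" using pos unfolding \<eta>_def by (metis less_irrefl nonzero_mult_div_cancel_left times_divide_eq_right)
    finally have \<eta>: "0 < \<eta>" "C * (\<eta> + \<eta> * (1 + L)) = e"
      using pos \<open>0 < e\<close> unfolding \<eta>_def by simp_all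
    obtain d1 where d1: "d1 > 0"
      "\<And>y. norm (y - x) < d1 \<Longrightarrow> norm (r y - r x - r' (y - x)) \<le> \<eta> * norm (y - x)"
      using r' \<eta>(1) unfolding has_derivative_within_alt by blast
    obtain d2 where d2: "d2 > 0" "\<And>p. norm (p - (x, G x)) < d2 \<Longrightarrow>
        norm (g p - g (x, G x) - g' (p - (x, G x))) \<le> \<eta> * norm (p - (x, G x))"
      using g' \<eta>(1) unfolding has_derivative_within_alt by blast
    show "\<exists>d>0. \<forall>y\<in>UNIV. norm (y - x) < d \<longrightarrow>
        norm (G y - G x - N (r' (y - x) - g' (y - x, 0))) \<le> e * norm (y - x)"
    proof (intro exI[of _ "min d1 (d2 / (1 + L))"] conjI ballI impI)
      show "0 < min d1 (d2 / (1 + L))" using d1(1) d2(1) \<open>L \<ge> 0\<close> by simp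
      fix y assume y: "norm (y - x) < min d1 (d2 / (1 + L))"
      let ?k = "y - x" and ?q = "G y - G x"
      have p: "(y, G y) - (x, G x) = (?k, ?q)" by simp
      have kq: "norm (?k, ?q) \<le> (1 + L) * norm ?k"
        using norm_Pair_le[of ?k ?q] lip(1)[of y] by (simp add: algebra_simps)
      also have "\<dots> < d2" using y \<open>L \<ge> 0\<close> by (simp add: pos_less_divide_eq mult.commute)
      finally have "norm (g (y, G y) - g (x, G x) - g' (?k, ?q)) \<le> \<eta> * norm (?k, ?q)"
        using d2(2)[of "(y, G y)"] by (simp only: p)
      also have "\<dots> \<le> \<eta> * ((1 + L) * norm ?k)" using kq \<eta>(1) by simp
      finally have eg: "norm (r y - r x - g' (?k, ?q)) \<le> \<eta> * (1 + L) * norm ?k"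
        by (simp only: G mult.assoc)
      have er: "norm (r y - r x - r' ?k) \<le> \<eta> * norm ?k" using d1(2)[of y] y by simp
      have "g' (?k, ?q) = g' (?k, 0) + g' (0, ?q)" using g'.add[of "(?k, 0)" "(0, ?q)"] by simp
      then have "?q - N (r' ?k - g' (?k, 0)) = N ((r y - r x - r' ?k) - (r y - r x - g' (?k, ?q)))"
        using N(2)[of ?q] by (simp add: N.diff N.add algebra_simps)
      also have "norm \<dots> \<le> norm ((r y - r x - r' ?k) - (r y - r x - g' (?k, ?q))) * C" by (rule C(2))
      also have "\<dots> \<le> (\<eta> * norm ?k + \<eta> * (1 + L) * norm ?k) * C"
        using C(1) order_trans[OF norm_triangle_ineq4 add_mono[OF er eg]] by (intro mult_right_mono) simp_all
      also have "\<dots> = (C * (\<eta> + \<eta> * (1 + L))) * norm ?k" by (simp add: algebra_simps)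
      also have "\<dots> = e * norm ?k" by (simp only: \<eta>(2))
      finally show "norm (?q - N (r' ?k - g' (?k, 0))) \<le> e * norm ?k" .
    qed
  qed
qed

lemma bdd_grad_graph:
  fixes G :: "'i \<Rightarrow> 'a::euclidean_space \<Rightarrow> 'b::real_normed_vector"
  assumes "bdd_grad j I (\<lambda>_. 1) G"
  shows "bdd_grad j I (\<lambda>_. 1) (\<lambda>i x. (x, G i x))"
proof (rule bdd_gradI)
  show "((\<lambda>x. (x, G i x)) has_derivative (\<lambda>h. (h, frechet_derivative (G i) (at x) h))) (at x)"
    if "i \<in> I" for i x
    using assms that frechet_derivative_works[of "G i" "at x"] unfolding bdd_grad_def
    by (intro has_derivative_Pair has_derivative_ident) auto
  fix b :: 'a assume "b \<in> Basis"
  then have "bdd_derivs j I (\<lambda>_. 1) (\<lambda>i x. (0 :: 'a, frechet_derivative (G i) (at x) b))"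
    using bdd_derivs_linear[OF bounded_linear_Pair[OF bounded_linear_zero bounded_linear_ident]
        bdd_grad_partial[OF assms]] by (simp add: partial_deriv_def)
  from bdd_derivs_add[OF bdd_derivs_param[of I "\<lambda>_. (b, 0)" "norm b" "\<lambda>_. 1"] this]
  show "bdd_derivs j I (\<lambda>_. 1) (\<lambda>i x. (b, frechet_derivative (G i) (at x) b))" by simp
qed

context
  fixes g :: "'a::euclidean_space \<times> 'b::euclidean_space \<Rightarrow> 'b" and \<beta> :: real
  assumes \<beta>: "0 < \<beta>"
    and mono: "\<And>x y y'. (g (x, y) - g (x, y')) \<bullet> (y - y') \<le> - \<beta> * (norm (y - y'))\<^sup>2"
begin

lemma fast_expanding: "\<beta> * norm (y - y') \<le> norm (g (x, y) - g (x, y'))"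
proof (cases "y = y'")
  case False
  have "\<beta> * norm (y - y') * norm (y - y') \<le> - ((g (x, y) - g (x, y')) \<bullet> (y - y'))"
    using mono[of x y y'] by (simp add: power2_eq_square)
  also have "\<dots> \<le> norm (g (x, y) - g (x, y')) * norm (y - y')"
    using Cauchy_Schwarz_ineq2[of "g (x, y) - g (x, y')" "y - y'"] by linarith
  finally show ?thesis using False by simp
qed simp

text \<open>The infinitesimal form of monotonicity: along a line in direction \<open>v\<close> the
  function \<open>?\<phi>\<close> is nondecreasing, so its derivative at 0 is nonnegative.\<close>

lemma fast_jac_coercive:
  assumes "g differentiable (at p)"
  shows "blinfun_apply (fast_jac g p) v \<bullet> v \<le> - \<beta> * (norm v)\<^sup>2"
proof -
  obtain x y where p: "p = (x, y)" by (cases p)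
  obtain g' where g': "(g has_derivative g') (at p)"
    using assms by (auto simp: differentiable_def)
  let ?\<phi> = "\<lambda>t. - (g (x, y + t *\<^sub>R v) \<bullet> v) - \<beta> * t * (norm v)\<^sup>2"
  have d: "((\<lambda>t. g (x, y + t *\<^sub>R v)) has_derivative (\<lambda>t. g' (0, t *\<^sub>R v))) (at 0)"
    by (rule has_derivative_compose[where g = g and f = "\<lambda>t. (x, y + t *\<^sub>R v)" and g' = g'])
      (use g' in \<open>auto intro!: derivative_eq_intros simp: p\<close>)
  have deriv: "(?\<phi> has_real_derivative - (g' (0, v) \<bullet> v) - \<beta> * (norm v)\<^sup>2) (at 0)"
    unfolding has_field_derivative_def
  proof (rule has_derivative_eq_rhs)
    show "(?\<phi> has_derivative (\<lambda>t. - (g' (0, t *\<^sub>R v) \<bullet> v) - \<beta> * t * (norm v)\<^sup>2)) (at 0)"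
      by (intro has_derivative_diff has_derivative_minus has_derivative_inner_left d)
        (auto intro!: derivative_eq_intros)
    have "g' (0, t *\<^sub>R v) = t *\<^sub>R g' (0, v)" for t
      using linear_scale[OF has_derivative_linear[OF g'], of t "(0, v)"] by simp
    then show "(\<lambda>t. - (g' (0, t *\<^sub>R v) \<bullet> v) - \<beta> * t * (norm v)\<^sup>2) = (*) (- (g' (0, v) \<bullet> v) - \<beta> * (norm v)\<^sup>2)"
      by (auto simp: algebra_simps)
  qed
  have "mono_on UNIV ?\<phi>"
  proof (rule mono_onI)
    fix s t :: real assume "s \<le> t"
    show "?\<phi> s \<le> ?\<phi> t"
    proof (cases "s = t")
      case False
      then have "0 < t - s" using \<open>s \<le> t\<close> by simp
      have "(t - s) * ((g (x, y + t *\<^sub>R v) - g (x, y + s *\<^sub>R v)) \<bullet> v) \<le> (t - s) * (- \<beta> * (t - s) * (norm v)\<^sup>2)"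
        using mono[of x "y + t *\<^sub>R v" "y + s *\<^sub>R v"]
        by (simp add: scaleR_diff_left[symmetric] power_mult_distrib power2_eq_square mult_ac)
      then have "(g (x, y + t *\<^sub>R v) - g (x, y + s *\<^sub>R v)) \<bullet> v \<le> - \<beta> * (t - s) * (norm v)\<^sup>2"
        using \<open>0 < t - s\<close> by (simp only: mult_le_cancel_left_pos)
      then show ?thesis by (simp add: algebra_simps)
    qed simp
  qed
  from mono_on_imp_deriv_nonneg[OF this deriv] have "0 \<le> - (g' (0, v) \<bullet> v) - \<beta> * (norm v)\<^sup>2"
    by (simp only: interior_UNIV UNIV_I simp_thms)
  then show ?thesis by (simp add: fast_jac_apply[OF g'])
qed

lemma fast_jac_inverse:
  assumes "\<And>p. g differentiable (at p)"
  obtains N where "\<And>p. N p o\<^sub>L fast_jac g p = id_blinfun" "\<And>p. fast_jac g p o\<^sub>L N p = id_blinfun"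
    "\<And>p. norm (N p) \<le> 1 / \<beta>"
  using coercive_inverse[OF \<beta> fast_jac_coercive[OF assms]] that by metis

text \<open>A bootstrap. The derivative of \<open>G\<close> is \<open>N (x, G x)\<close> applied to
  derivatives of \<open>r\<close> and of \<open>g\<close> at \<open>(x, G x)\<close>, so it involves
  \<open>G\<close> but not the derivatives of \<open>G\<close>. Bounds up to some order therefore
  yield the next one. Differentiability itself rests on the Lipschitz bound that
  \<open>fast_expanding\<close> provides.\<close>

lemma implicit_bdd_grad:
  fixes G r :: "'i \<Rightarrow> 'a \<Rightarrow> 'b"
  assumes g: "bdd_grad j I (\<lambda>_. 1) (\<lambda>_. g)" and r: "bdd_grad j I (\<lambda>_. 1) r"
    and G: "\<And>i x. i \<in> I \<Longrightarrow> g (x, G i x) = r i x"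
  shows "bdd_grad j I (\<lambda>_. 1) G"
\<comment> \<open>Over an empty index set the assumption on the constant family \<open>g\<close>
  says nothing about \<open>g\<close> itself.\<close>
proof (cases "I = {}")
  case True
  then show ?thesis by (simp add: bdd_grad_def bdd_derivs_empty)
next
  case False
  then have dg: "g differentiable (at p)" for p using g unfolding bdd_grad_def by blast
  then have g': "(g has_derivative frechet_derivative g (at p)) (at p)" for p
    using frechet_derivative_works by blast
  obtain N where N: "\<And>p. N p o\<^sub>L fast_jac g p = id_blinfun" "\<And>p. fast_jac g p o\<^sub>L N p = id_blinfun"
    "\<And>p. norm (N p) \<le> 1 / \<beta>" using fast_jac_inverse[OF dg] by metis
  obtain Lg where Lg: "Lg \<ge> 0" "\<And>p q. norm (g p - g q) \<le> Lg * norm (p - q)"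
    using bdd_grad_lipschitz[OF g] False by blast
  obtain Lr where Lr: "Lr \<ge> 0" "\<And>i x y. i \<in> I \<Longrightarrow> norm (r i x - r i y) \<le> Lr * norm (x - y)"
    using bdd_grad_lipschitz[OF r] by blast
  let ?D = "\<lambda>i x h. blinfun_apply (N (x, G i x))
    (frechet_derivative (r i) (at x) h - frechet_derivative g (at (x, G i x)) (h, 0))"
  have der: "(G i has_derivative ?D i x) (at x)" if i: "i \<in> I" for i x
  proof (rule implicit_has_derivative[OF g' _ G[OF i]])
    show "(r i has_derivative frechet_derivative (r i) (at x)) (at x)"
      using r i frechet_derivative_works unfolding bdd_grad_def by blast
    show "norm (G i y - G i x) \<le> ((Lr + Lg) / \<beta>) * norm (y - x)" for y
    proof -
      have "\<beta> * norm (G i y - G i x) \<le> norm (g (y, G i y) - g (y, G i x))"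
        by (rule fast_expanding)
      also have "\<dots> = norm ((r i y - r i x) - (g (y, G i x) - g (x, G i x)))"
        using G[OF i] by simp
      also have "\<dots> \<le> Lr * norm (y - x) + Lg * norm ((y, G i x) - (x, G i x))"
        by (intro order_trans[OF norm_triangle_ineq4] add_mono Lr(2)[OF i] Lg(2))
      also have "norm ((y, G i x) - (x, G i x)) = norm (y - x)" by (simp add: norm_Pair)
      finally show ?thesis using \<beta> by (simp add: field_simps)
    qed
    show "(Lr + Lg) / \<beta> \<ge> 0" using Lr(1) Lg(1) \<beta> by simp
    show "bounded_linear (blinfun_apply (N (x, G i x)))" by (rule blinfun.bounded_linear_right)
    show "blinfun_apply (N (x, G i x)) (frechet_derivative g (at (x, G i x)) (0, v)) = v" for v
      using arg_cong[OF N(1)[of "(x, G i x)"], of "\<lambda>f. blinfun_apply f v"]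
      by (simp add: fast_jac_apply[OF g'])
  qed
  have step: "bdd_grad k I (\<lambda>_. 1) G" if "k \<le> j"
    and part: "\<And>c. c \<in> Basis \<Longrightarrow> bdd_derivs k I (\<lambda>_. 1) (\<lambda>i x. partial_deriv c g (x, G i x))" for k
  proof (rule bdd_gradI[OF der])
    fix b :: 'a assume b: "b \<in> Basis"
    have "bdd_derivs k I (\<lambda>_. 1) (\<lambda>i x. fast_jac g (x, G i x))" by (rule bdd_derivs_fast_jac[OF part])
    then have n: "bdd_derivs k I (\<lambda>_. 1) (\<lambda>i x. N (x, G i x))"
    proof (rule bdd_derivs_inverse[rotated 3])
      show "unif_bdd I (\<lambda>_. 1) (\<lambda>i x. N (x, G i x))"
        unfolding unif_bdd_def using N(3) by (intro exI[of _ "1 / \<beta>"]) simp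
    qed (rule N)+
    have "bdd_derivs k I (\<lambda>_. 1) (\<lambda>i x. partial_deriv b (r i) x - partial_deriv (b, 0) g (x, G i x))"
      using b bdd_grad_partial[OF bdd_grad_le[OF r \<open>k \<le> j\<close>] b]
      by (intro bdd_derivs_diff part) (simp_all add: Basis_prod_def)
    from bdd_derivs_bilinear[OF bounded_bilinear_blinfun_apply n this]
    show "bdd_derivs k I (\<lambda>_. 1) (\<lambda>i x. ?D i x b)" by (simp add: partial_deriv_def)
  qed
  have "bdd_grad k I (\<lambda>_. 1) G" if "k \<le> j" for k using that
  proof (induction k)
    case 0
    show ?case
    proof (rule step[OF 0])
      fix c :: "'a \<times> 'b" assume "c \<in> Basis"
      then have "unif_bdd I (\<lambda>_. 1) (\<lambda>_. partial_deriv c g)"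
        using bdd_grad_partial[OF g] bdd_derivs_unif_bdd by blast
      then show "bdd_derivs 0 I (\<lambda>_. 1) (\<lambda>i x. partial_deriv c g (x, G i x))"
        unfolding unif_bdd_def bdd_derivs.simps by blast
    qed
  next
    case (Suc k)
    \<comment> \<open>Composition of order \<open>Suc k\<close> asks only for
      \<open>bdd_grad k\<close> of the inner map; this is the gain of one order that drives the
      induction.\<close>
    have G': "bdd_grad k I (\<lambda>_. 1) (\<lambda>i x. (x, G i x))" using Suc by (intro bdd_grad_graph) simp
    show ?case
    proof (rule step[OF Suc.prems])
      fix c :: "'a \<times> 'b" assume "c \<in> Basis"
      then show "bdd_derivs (Suc k) I (\<lambda>_. 1) (\<lambda>i x. partial_deriv c g (x, G i x))"
        by (rule bdd_derivs_comp_Suc[OF bdd_grad_partial[OF bdd_grad_le[OF g Suc.prems]] G'])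
    qed
  qed
  then show ?thesis by simp
qed

text \<open>The functions themselves need one derivative less than is estimated: differentiating the
  equation expresses the top derivative of the difference through lower ones and those of \<open>s\<close>.\<close>

lemma implicit_bdd_derivs_diff:
  fixes G G' s :: "'i \<Rightarrow> 'a \<Rightarrow> 'b"
  assumes g: "bdd_grad j I (\<lambda>_. 1) (\<lambda>_. g)"
    and "\<And>m. j = Suc m \<Longrightarrow> bdd_grad m I (\<lambda>_. 1) G" "\<And>m. j = Suc m \<Longrightarrow> bdd_grad m I (\<lambda>_. 1) G'"
    and s: "\<And>i x. i \<in> I \<Longrightarrow> g (x, G i x) - g (x, G' i x) = s i x" and "bdd_derivs j I w s"
  shows "bdd_derivs j I w (\<lambda>i x. G i x - G' i x)"
  using assms(1-3,5)
proof (induction j)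
  case 0
  have le: "norm (G i x - G' i x) \<le> (1 / \<beta>) * norm (s i x)" if "i \<in> I" for i x
    using fast_expanding[of "G i x" "G' i x" x] \<beta> by (simp add: s[OF that] field_simps)
  have "unif_bdd I w s" using 0 by simp
  from unif_bdd_mono[OF this le] show ?case using \<beta> by simp
next
  case (Suc j)
  note G = Suc.prems(2)[OF refl] and G' = Suc.prems(3)[OF refl]
  have bs: "bdd_derivs j I w s" by (rule bdd_derivs_Suc_D[OF Suc.prems(4)])
  have gj: "bdd_grad j I (\<lambda>_. 1) (\<lambda>_. g)" by (rule bdd_grad_le[OF Suc.prems(1)]) simp
  have D: "bdd_derivs j I w (\<lambda>i x. G i x - G' i x)"
    by (rule Suc.IH[OF gj _ _ bs]) (auto intro: bdd_grad_le[OF G] bdd_grad_le[OF G'])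
  show ?case
  proof (cases "I = {}")
    case True
    show ?thesis unfolding True by (rule bdd_derivs_empty)
  next
    case False
    then have dg: "g differentiable (at p)" for p using g unfolding bdd_grad_def by blast
    then have g': "(g has_derivative frechet_derivative g (at p)) (at p)" for p
      using frechet_derivative_works by blast
    obtain N where N: "\<And>p. N p o\<^sub>L fast_jac g p = id_blinfun" "\<And>p. fast_jac g p o\<^sub>L N p = id_blinfun"
      "\<And>p. norm (N p) \<le> 1 / \<beta>" using fast_jac_inverse[OF dg] by metis
    let ?p = "\<lambda>i x. (x, G i x)" and ?p' = "\<lambda>i x. (x, G' i x)"
    note dG = G[unfolded bdd_grad_def, THEN conjunct1, rule_format, THEN frechet_derivative_works[THEN iffD1]]
      and dG' = G'[unfolded bdd_grad_def, THEN conjunct1, rule_format, THEN frechet_derivative_works[THEN iffD1]]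
    \<comment> \<open>Obtained by differentiating both equations and moving everything but the fast
      Jacobian at \<open>(x, G x)\<close>, applied to the difference of derivatives, to one side.
      The differences left over are of partial derivatives of \<open>g\<close> at the two graphs,
      controlled by \<open>G - G'\<close> at the lower order.\<close>
    let ?E = "\<lambda>b i x. partial_deriv b (s i) x
        - (partial_deriv (b, 0) g (?p i x) - partial_deriv (b, 0) g (?p' i x))
        - blinfun_apply (fast_jac g (?p i x) - fast_jac g (?p' i x)) (partial_deriv b (G' i) x)"
    have eq: "frechet_derivative (G i) (at x) b - frechet_derivative (G' i) (at x) b
        = blinfun_apply (N (?p i x)) (?E b i x)" if i: "i \<in> I" for i x b
    proof -
      have graph: "((\<lambda>x. g (x, H x)) has_derivative (\<lambda>h. frechet_derivative g (at (x, H x)) (h, H' h))) (at x)"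
        if "(H has_derivative H') (at x)" for H H'
        using has_derivative_compose[OF has_derivative_Pair[OF has_derivative_ident that] g'] .
      have split: "frechet_derivative g (at p) (b, v) = partial_deriv (b, 0) g p + blinfun_apply (fast_jac g p) v" for p v
        using linear_add[OF has_derivative_linear[OF g'[of p]], of "(b, 0)" "(0, v)"]
        by (simp add: fast_jac_apply[OF g'] partial_deriv_def)
      have "s i = (\<lambda>x. g (?p i x) - g (?p' i x))" using s[OF i] by auto
      then have "partial_deriv b (s i) x = frechet_derivative g (at (?p i x)) (b, frechet_derivative (G i) (at x) b)
          - frechet_derivative g (at (?p' i x)) (b, frechet_derivative (G' i) (at x) b)"
        using partial_deriv_eq[OF has_derivative_diff[OF graph[OF dG[OF i]] graph[OF dG'[OF i]]]] by simp
      then have "?E b i x = blinfun_apply (fast_jac g (?p i x))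
          (frechet_derivative (G i) (at x) b - frechet_derivative (G' i) (at x) b)"
        by (simp add: split blinfun.diff_left blinfun.diff_right partial_deriv_def[of b "G' i"])
      then show ?thesis
        using arg_cong[OF N(1)[of "?p i x"], of "\<lambda>f. blinfun_apply f
          (frechet_derivative (G i) (at x) b - frechet_derivative (G' i) (at x) b)"] by simp
    qed
    show ?thesis unfolding bdd_derivs_Suc
    proof
      show "unif_bdd I w (\<lambda>i x. G i x - G' i x)" by (rule bdd_derivs_unif_bdd[OF D])
      show "bdd_grad j I w (\<lambda>i x. G i x - G' i x)"
      proof (rule bdd_gradI)
        show "((\<lambda>x. G i x - G' i x) has_derivative
            (\<lambda>h. frechet_derivative (G i) (at x) h - frechet_derivative (G' i) (at x) h)) (at x)"
          if "i \<in> I" for i x by (rule has_derivative_diff[OF dG[OF that] dG'[OF that]])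
        fix b :: 'a assume b: "b \<in> Basis"
        note p = bdd_grad_graph[OF G] and p' = bdd_grad_graph[OF G']
        have pp': "bdd_derivs j I w (\<lambda>i x. ?p i x - ?p' i x)"
          using bdd_derivs_linear[OF bounded_linear_Pair[OF bounded_linear_zero[where 'b = 'a] bounded_linear_ident] D]
          by simp
        have part: "bdd_derivs (Suc j) I (\<lambda>_. 1) (\<lambda>_. partial_deriv c g)" if "c \<in> Basis" for c
          by (rule bdd_grad_partial[OF Suc.prems(1) that])
        have diff: "bdd_derivs j I w (\<lambda>i x. partial_deriv c g (?p i x) - partial_deriv c g (?p' i x))"
          if "c \<in> Basis" for c
          by (rule bdd_derivs_comp_diff[OF _ p p' pp'])
            (use part[OF that] bdd_derivs_Suc in blast)
        have "bdd_derivs j I (\<lambda>_. 1) (\<lambda>i x. fast_jac g (?p i x))"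
          by (rule bdd_derivs_fast_jac) (rule bdd_derivs_comp[OF bdd_derivs_Suc_D[OF part] p])
        then have n: "bdd_derivs j I (\<lambda>_. 1) (\<lambda>i x. N (?p i x))"
        proof (rule bdd_derivs_inverse[rotated 3])
          show "unif_bdd I (\<lambda>_. 1) (\<lambda>i x. N (?p i x))"
            unfolding unif_bdd_def using N(3) by (intro exI[of _ "1 / \<beta>"]) simp
        qed (rule N)+
        have m: "bdd_derivs j I w (\<lambda>i x. blinfun_apply (fast_jac g (?p i x) - fast_jac g (?p' i x)) (partial_deriv b (G' i) x))"
          using bdd_derivs_bilinear[OF bounded_bilinear_blinfun_apply bdd_derivs_fast_jac_diff[OF diff]
              bdd_grad_partial[OF G' b]] by simp
        have "bdd_derivs j I w (?E b)"
          using Suc.prems(4) b m by (intro bdd_derivs_diff diff) (simp_all add: Basis_prod_def)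
        from bdd_derivs_bilinear[OF bounded_bilinear_blinfun_apply n this]
        have "bdd_derivs j I w (\<lambda>i x. blinfun_apply (N (?p i x)) (?E b i x))" by simp
        then show "bdd_derivs j I w (\<lambda>i x. frechet_derivative (G i) (at x) b - frechet_derivative (G' i) (at x) b)"
          by (rule bdd_derivs_cong[THEN iffD2, rotated]) (rule eq)
      qed
    qed
  qed
qed

end

subsection \<open>From Sobolev norms to pointwise bounds\<close>

text \<open>A closed set of full Lebesgue measure is the whole space, so for a continuous function
  the essential bound holds at every point.\<close>

lemma Linf_norm_bound:
  fixes h :: "'a::euclidean_space \<Rightarrow> real"
  assumes h: "continuous_on UNIV h" and fin: "Linf_norm h < \<infinity>"
  shows "\<exists>C. \<forall>p. \<bar>h p\<bar> \<le> C"
proof -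
  define C where "C = enn2real (Linf_norm h)"
  have "AE p in lborel. ennreal \<bar>h p\<bar> \<le> ennreal C"
    using esssup_AE[of "\<lambda>p. ennreal \<bar>h p\<bar>" lborel] fin by (simp add: C_def Linf_norm_def)
  then have "AE p in lborel. p \<in> {p. \<bar>h p\<bar> \<le> C}"
    by eventually_elim (simp add: C_def)
  then have ae: "AE p in lebesgue. p \<in> {p. \<bar>h p\<bar> \<le> C}" by (rule AE_completion)
  have "closed {p. \<bar>h p\<bar> \<le> C}"
    by (rule closed_Collect_le[OF continuous_on_rabs[OF h] continuous_on_const])
  from mem_closed_if_AE_lebesgue[OF this ae] show ?thesis by blast
qed

lemma Ck_Suc_D: "Ck (Suc k) \<xi> \<Longrightarrow> Ck k \<xi>"
proof (induction k arbitrary: \<xi>)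
  case 0
  then have "\<xi> differentiable_on UNIV" by (simp add: differentiable_on_def)
  then show ?case by (simp add: differentiable_imp_continuous_on)
qed auto

lemma Ck_le: "Ck k \<xi> \<Longrightarrow> j \<le> k \<Longrightarrow> Ck j \<xi>"
  by (induction k) (auto simp del: Ck.simps simp: le_Suc_eq dest: Ck_Suc_D)

lemma continuous_iter_partial:
  assumes "Ck (length bs) \<xi>" "set bs \<subseteq> Basis"
  shows "continuous_on UNIV (iter_partial bs \<xi>)"
  using assms by (induction bs arbitrary: \<xi>) auto

lemma iter_partial_bounded:
  fixes \<xi> :: "'a::euclidean_space \<Rightarrow> 'b::real_normed_vector"
  assumes C: "Ck j \<xi>" and fin: "Linf_norm (nabla_norm j \<xi>) < \<infinity>"
    and bs: "set bs \<subseteq> Basis" "length bs = j"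
  shows "\<exists>C. \<forall>p. norm (iter_partial bs \<xi> p) \<le> C"
proof -
  let ?A = "{bs. set bs \<subseteq> (Basis :: 'a set) \<and> length bs = j}"
  have "continuous_on UNIV (nabla_norm j \<xi>)" unfolding nabla_norm_def[abs_def]
    by (intro continuous_intros) (use C continuous_iter_partial[of _ \<xi>] in auto)
  then obtain c where c: "\<And>p. \<bar>nabla_norm j \<xi> p\<bar> \<le> c" using Linf_norm_bound fin by blast
  have "norm (iter_partial bs \<xi> p) \<le> c" for p
  proof -
    have "(norm (iter_partial bs \<xi> p))\<^sup>2 \<le> (\<Sum>bs\<in>?A. (norm (iter_partial bs \<xi> p))\<^sup>2)"
      by (rule member_le_sum) (use bs finite_lists_length_eq[of "Basis :: 'a set"] in auto)
    then have "norm (iter_partial bs \<xi> p) \<le> nabla_norm j \<xi> p"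
      unfolding nabla_norm_def by (rule real_le_rsqrt)
    then show ?thesis using c[of p] by linarith
  qed
  then show ?thesis by blast
qed

lemma bdd_derivs_Ck:
  assumes "Ck j \<xi>" "\<And>bs. set bs \<subseteq> Basis \<Longrightarrow> length bs \<le> j \<Longrightarrow> \<exists>C. \<forall>p. norm (iter_partial bs \<xi> p) \<le> C"
  shows "bdd_derivs j I (\<lambda>_. 1) (\<lambda>_. \<xi>)"
  using assms
proof (induction j arbitrary: \<xi>)
  case 0
  then show ?case using 0(2)[of "[]"] by (auto simp: unif_bdd_def)
next
  case (Suc j)
  have "unif_bdd I (\<lambda>_. 1) (\<lambda>_. \<xi>)" using Suc.prems(2)[of "[]"] by (auto simp: unif_bdd_def)
  moreover have "bdd_derivs j I (\<lambda>_. 1) (\<lambda>_. partial_deriv b \<xi>)" if b: "b \<in> Basis" for b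
  proof (rule Suc.IH)
    show "Ck j (partial_deriv b \<xi>)" using Suc.prems(1) b by simp
    show "\<exists>C. \<forall>p. norm (iter_partial bs (partial_deriv b \<xi>) p) \<le> C"
      if "set bs \<subseteq> Basis" "length bs \<le> j" for bs
      using Suc.prems(2)[of "b # bs"] b that by simp
  qed
  ultimately show ?case using Suc.prems(1) by simp
qed

lemma bdd_derivs_sobolev:
  assumes C: "Ck K \<xi>" and fin: "sobolev_inf_norm K \<xi> < \<infinity>"
  shows "bdd_derivs K I (\<lambda>_. 1) (\<lambda>_. \<xi>)"
proof (rule bdd_derivs_Ck[OF C])
  fix bs :: "'a list" assume bs: "set bs \<subseteq> Basis" "length bs \<le> K"
  have "Linf_norm (nabla_norm (length bs) \<xi>) \<le> sobolev_inf_norm K \<xi>"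
    unfolding sobolev_inf_norm_def using bs(2) by (intro Max_ge) auto
  then have "Linf_norm (nabla_norm (length bs) \<xi>) < \<infinity>" using fin by (rule order_le_less_trans)
  from iter_partial_bounded[OF Ck_le[OF C bs(2)] this bs(1) refl]
  show "\<exists>C. \<forall>p. norm (iter_partial bs \<xi> p) \<le> C" .
qed

lemma bdd_grad_sobolev:
  assumes C: "Ck (Suc K) \<xi>" and fin: "grad_sobolev_inf_norm K \<xi> < \<infinity>"
  shows "bdd_grad K I (\<lambda>_. 1) (\<lambda>_. \<xi>)"
  unfolding bdd_grad_def
proof (intro conjI ballI allI)
  show "\<xi> differentiable at x" for x using C by simp
  fix b :: 'a assume b: "b \<in> Basis"
  show "bdd_derivs K I (\<lambda>_. 1) (\<lambda>_. partial_deriv b \<xi>)"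
  proof (rule bdd_derivs_Ck)
    show "Ck K (partial_deriv b \<xi>)" using C b by simp
    fix bs :: "'a list" assume bs: "set bs \<subseteq> Basis" "length bs \<le> K"
    have "Linf_norm (nabla_norm (Suc (length bs)) \<xi>) \<le> grad_sobolev_inf_norm K \<xi>"
      unfolding grad_sobolev_inf_norm_def using bs(2) by (intro Max_ge) auto
    then have "Linf_norm (nabla_norm (Suc (length bs)) \<xi>) < \<infinity>" using fin by (rule order_le_less_trans)
    from iter_partial_bounded[OF Ck_le[OF C] this, of "b # bs"] bs b
    show "\<exists>C. \<forall>p. norm (iter_partial bs (partial_deriv b \<xi>) p) \<le> C" by simp
  qed
qed

subsection \<open>The hierarchy of slow manifolds\<close>

lemma bdd_derivs_graph_comp:
  fixes f :: "'a::euclidean_space \<times> 'b::euclidean_space \<Rightarrow> 'c::real_normed_vector"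
  assumes "bdd_derivs j I (\<lambda>_. 1) (\<lambda>_. f)" "bdd_grad j I (\<lambda>_. 1) G"
  shows "bdd_derivs j I (\<lambda>_. 1) (\<lambda>i x. f (x, G i x))"
  by (rule bdd_derivs_comp[OF assms(1) bdd_grad_graph[OF assms(2)]])

text \<open>The right-hand side of the next equation up to the factor \<epsilon>. It is bounded
  because \<open>f\<close> is, although \<open>G\<close> need not be; written as coordinates of
  \<open>f\<close> times partial derivatives of \<open>G\<close>, it falls under the product
  rule.\<close>

lemma bdd_derivs_transport:
  fixes G :: "'i \<Rightarrow> 'a::euclidean_space \<Rightarrow> 'b::euclidean_space"
  assumes f: "bdd_derivs j I (\<lambda>_. 1) (\<lambda>_. f)" and G: "bdd_grad j I (\<lambda>_. 1) G"
  shows "bdd_derivs j I (\<lambda>_. 1) (\<lambda>i x. frechet_derivative (G i) (at x) (f (x, G i x)))"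
proof -
  have "bdd_derivs j I (\<lambda>_. 1) (\<lambda>i x. (f (x, G i x) \<bullet> b) *\<^sub>R partial_deriv b (G i) x)"
    if "b \<in> Basis" for b
    using bdd_derivs_coord_scaleR[OF bdd_derivs_graph_comp[OF f G] bdd_grad_partial[OF G that]] by simp
  then have "bdd_derivs j I (\<lambda>_. 1) (\<lambda>i x. \<Sum>b\<in>Basis. (f (x, G i x) \<bullet> b) *\<^sub>R partial_deriv b (G i) x)"
    by (rule bdd_derivs_sum)
  then show ?thesis
    by (rule bdd_derivs_cong[THEN iffD1, rotated])
      (simp add: frechet_derivative_at[OF bdd_grad_has_derivative[OF G], symmetric])
qed

text \<open>The residual of two successive manifolds splits into D(G - G') applied to
  \<open>f\<close> at \<open>G\<close>, and DG' applied to the difference of \<open>f\<close>. The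
  first part spends a derivative of \<open>G - G'\<close>, hence the order \<open>Suc j\<close> in
  the assumption.\<close>

lemma bdd_derivs_transport_diff:
  fixes G G' :: "'i \<Rightarrow> 'a::euclidean_space \<Rightarrow> 'b::euclidean_space"
  assumes f: "bdd_derivs j I (\<lambda>_. 1) (\<lambda>_. f)" "bdd_grad j I (\<lambda>_. 1) (\<lambda>_. f)"
    and G: "bdd_grad j I (\<lambda>_. 1) G" and G': "bdd_grad j I (\<lambda>_. 1) G'"
    and D: "bdd_derivs (Suc j) I w (\<lambda>i x. G i x - G' i x)"
  shows "bdd_derivs j I w (\<lambda>i x. frechet_derivative (G i) (at x) (f (x, G i x))
    - frechet_derivative (G' i) (at x) (f (x, G' i x)))"
proof -
  have pp': "bdd_derivs j I w (\<lambda>i x. (x, G i x) - (x, G' i x))"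
    using bdd_derivs_linear[OF bounded_linear_Pair[OF bounded_linear_zero[where 'b = 'a] bounded_linear_ident]
        bdd_derivs_Suc_D[OF D]] by simp
  have df: "bdd_derivs j I w (\<lambda>i x. f (x, G i x) - f (x, G' i x))"
    by (rule bdd_derivs_comp_diff[OF f(2) bdd_grad_graph[OF G] bdd_grad_graph[OF G'] pp'])
  have "bdd_derivs j I w (\<lambda>i x. \<Sum>b\<in>Basis. (f (x, G i x) \<bullet> b) *\<^sub>R partial_deriv b (\<lambda>x. G i x - G' i x) x
      + ((f (x, G i x) - f (x, G' i x)) \<bullet> b) *\<^sub>R partial_deriv b (G' i) x)"
  proof (intro bdd_derivs_sum bdd_derivs_add)
    fix b :: 'a assume b: "b \<in> Basis"
    have "bdd_derivs j I w (\<lambda>i. partial_deriv b (\<lambda>x. G i x - G' i x))" using D b by simp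
    from bdd_derivs_coord_scaleR[OF bdd_derivs_graph_comp[OF f(1) G] this]
    show "bdd_derivs j I w (\<lambda>i x. (f (x, G i x) \<bullet> b) *\<^sub>R partial_deriv b (\<lambda>x. G i x - G' i x) x)" by simp
    from bdd_derivs_coord_scaleR[OF df bdd_grad_partial[OF G' b]]
    show "bdd_derivs j I w (\<lambda>i x. ((f (x, G i x) - f (x, G' i x)) \<bullet> b) *\<^sub>R partial_deriv b (G' i) x)" by simp
  qed
  then show ?thesis
  proof (rule bdd_derivs_cong[THEN iffD1, rotated])
    fix i x assume i: "i \<in> I"
    note g = bdd_grad_has_derivative[OF G i, of x] and g' = bdd_grad_has_derivative[OF G' i, of x]
    have pd: "partial_deriv b (\<lambda>x. G i x - G' i x) x = partial_deriv b (G i) x - partial_deriv b (G' i) x" for b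
      using partial_deriv_eq[OF has_derivative_diff[OF g g'], of b] partial_deriv_eq[OF g, of b]
        partial_deriv_eq[OF g', of b] by simp
    show "(\<Sum>b\<in>Basis. (f (x, G i x) \<bullet> b) *\<^sub>R partial_deriv b (\<lambda>x. G i x - G' i x) x
      + ((f (x, G i x) - f (x, G' i x)) \<bullet> b) *\<^sub>R partial_deriv b (G' i) x) =
      frechet_derivative (G i) (at x) (f (x, G i x)) - frechet_derivative (G' i) (at x) (f (x, G' i x))"
      unfolding frechet_derivative_at[OF g, symmetric] frechet_derivative_at[OF g', symmetric]
        sum_subtractf[symmetric]
      unfolding pd by (intro sum.cong refl) (simp add: algebra_simps)
  qed
qed

text \<open>\<open>S k\<close> is the transport term of \<open>G k\<close>, and \<open>S' k\<close>
  the one that defines \<open>G k\<close>; the value 0 at k = 0 makes the equation uniform in k. The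
  three claims are carried together because the equation for \<open>G (Suc k)\<close> is meaningful
  only once \<open>G k\<close> is known to be differentiable, which is the premise inside
  \<open>GSuc\<close>.\<close>

lemma slow_manifold_hierarchy:
  fixes f :: "'a::euclidean_space \<times> 'b::euclidean_space \<Rightarrow> 'a" and g :: "'a \<times> 'b \<Rightarrow> 'b"
    and G :: "nat \<Rightarrow> real \<Rightarrow> 'a \<Rightarrow> 'b"
  assumes "0 < \<beta>" and mono: "\<And>x y y'. (g (x, y) - g (x, y')) \<bullet> (y - y') \<le> - \<beta> * (norm (y - y'))\<^sup>2"
    and f: "bdd_derivs K I (\<lambda>_. 1) (\<lambda>_. f)" and g: "bdd_grad K I (\<lambda>_. 1) (\<lambda>_. g)"
    and I: "I \<subseteq> {0..1}"
    and G0: "\<And>\<epsilon> x. \<epsilon> \<in> I \<Longrightarrow> g (x, G 0 \<epsilon> x) = 0"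
    and GSuc: "\<And>k \<epsilon> x. \<epsilon> \<in> I \<Longrightarrow> (\<And>x. G k \<epsilon> differentiable (at x)) \<Longrightarrow>
      g (x, G (Suc k) \<epsilon> x) = \<epsilon> *\<^sub>R frechet_derivative (G k \<epsilon>) (at x) (f (x, G k \<epsilon> x))"
  defines "S \<equiv> \<lambda>k \<epsilon> x. frechet_derivative (G k \<epsilon>) (at x) (f (x, G k \<epsilon> x))"
  defines "S' \<equiv> \<lambda>k \<epsilon> x. case k of 0 \<Rightarrow> 0 | Suc l \<Rightarrow> S l \<epsilon> x"
  assumes "k \<le> K"
  shows "bdd_grad (K - k) I (\<lambda>_. 1) (G k) \<and>
    bdd_derivs (K - k) I (\<lambda>\<epsilon>. \<epsilon> ^ k) (\<lambda>\<epsilon> x. S k \<epsilon> x - S' k \<epsilon> x) \<and>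
    (\<forall>\<epsilon>\<in>I. \<forall>x. g (x, G k \<epsilon> x) = \<epsilon> *\<^sub>R S' k \<epsilon> x)"
  using \<open>k \<le> K\<close>
proof (induction k)
  case 0
  \<comment> \<open>The zeroth manifold solves the equation with right-hand side 0; its
    differentiability is an outcome of the implicit equation.\<close>
  have "bdd_grad K I (\<lambda>_. 1) (\<lambda>\<epsilon> x. 0 :: 'b)" for I :: "real set"
    by (rule bdd_gradI[OF has_derivative_const]) (rule bdd_derivs_zero)
  then have "bdd_grad K I (\<lambda>_. 1) (G 0)"
    by (rule implicit_bdd_grad[OF \<open>0 < \<beta>\<close> mono g _ G0])
  then show ?case using bdd_derivs_transport[OF f, of "G 0"] G0 by (simp add: S_def S'_def)
next
  case (Suc k)
  define m where "m = K - Suc k"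
  have Km: "K - k = Suc m" and mK: "Suc m \<le> K" using Suc.prems by (auto simp: m_def)
  from Suc have G: "bdd_grad (Suc m) I (\<lambda>_. 1) (G k)"
    and R: "bdd_derivs (Suc m) I (\<lambda>\<epsilon>. \<epsilon> ^ k) (\<lambda>\<epsilon> x. S k \<epsilon> x - S' k \<epsilon> x)"
    and eq: "\<And>\<epsilon> x. \<epsilon> \<in> I \<Longrightarrow> g (x, G k \<epsilon> x) = \<epsilon> *\<^sub>R S' k \<epsilon> x"
    by (simp_all add: Km)
  have eqS: "g (x, G (Suc k) \<epsilon> x) = \<epsilon> *\<^sub>R S k \<epsilon> x" if "\<epsilon> \<in> I" for \<epsilon> x
    unfolding S_def by (rule GSuc[OF that]) (use G that in \<open>simp add: bdd_grad_def\<close>)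
  have fm: "bdd_derivs (Suc m) I (\<lambda>_. 1) (\<lambda>_. f)" by (rule bdd_derivs_le[OF f mK])
  have gm: "bdd_grad (Suc m) I (\<lambda>_. 1) (\<lambda>_. g)" by (rule bdd_grad_le[OF g mK])
  have "bdd_derivs (Suc m) I (\<lambda>_. 1) (\<lambda>\<epsilon> (x :: 'a). \<epsilon>)"
    by (rule bdd_derivs_param[where C = 1]) (use I in auto)
  from bdd_derivs_bilinear[OF bounded_bilinear_scaleR this bdd_derivs_transport[OF fm G]]
  have "bdd_derivs (Suc m) I (\<lambda>_. 1) (\<lambda>\<epsilon> x. \<epsilon> *\<^sub>R S k \<epsilon> x)" by (simp add: S_def)
  then have "bdd_grad m I (\<lambda>_. 1) (\<lambda>\<epsilon> x. \<epsilon> *\<^sub>R S k \<epsilon> x)" using bdd_derivs_Suc by blast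
  from implicit_bdd_grad[OF \<open>0 < \<beta>\<close> mono bdd_grad_le[OF gm] this eqS]
  have G': "bdd_grad m I (\<lambda>_. 1) (G (Suc k))" by simp
  \<comment> \<open>The factor \<epsilon> is now counted with weight \<epsilon> instead of 1: the
    earlier version kept derivatives bounded, this one gains the power.\<close>
  have "bdd_derivs (Suc m) I (\<lambda>\<epsilon>. \<epsilon>) (\<lambda>\<epsilon> (x :: 'a). \<epsilon>)"
    by (rule bdd_derivs_param[where C = 1]) (use I in auto)
  from bdd_derivs_bilinear[OF bounded_bilinear_scaleR this R]
  have s: "bdd_derivs (Suc m) I (\<lambda>\<epsilon>. \<epsilon> ^ Suc k) (\<lambda>\<epsilon> x. \<epsilon> *\<^sub>R (S k \<epsilon> x - S' k \<epsilon> x))" by simp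
  have Gm: "bdd_grad m I (\<lambda>_. 1) (G k)" by (rule bdd_grad_le[OF G]) simp
  \<comment> \<open>\<open>G (Suc k)\<close> is controlled in the orders 1 to m + 1 only; the
    difference is estimated up to that same order, which leaves m for the next residual.\<close>
  have "bdd_derivs (Suc m) I (\<lambda>\<epsilon>. \<epsilon> ^ Suc k) (\<lambda>\<epsilon> x. G (Suc k) \<epsilon> x - G k \<epsilon> x)"
  proof (rule implicit_bdd_derivs_diff[OF \<open>0 < \<beta>\<close> mono gm _ _ _ s])
    show "bdd_grad l I (\<lambda>_. 1) (G (Suc k))" if "Suc m = Suc l" for l using G' that by simp
    show "bdd_grad l I (\<lambda>_. 1) (G k)" if "Suc m = Suc l" for l using Gm that by simp
    show "g (x, G (Suc k) \<epsilon> x) - g (x, G k \<epsilon> x) = \<epsilon> *\<^sub>R (S k \<epsilon> x - S' k \<epsilon> x)" if "\<epsilon> \<in> I" for \<epsilon> x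
      using eq[OF that] eqS[OF that] by (simp add: scaleR_diff_right)
  qed
  from bdd_derivs_transport_diff[OF bdd_derivs_Suc_D[OF fm] _ G' Gm this]
  have "bdd_derivs m I (\<lambda>\<epsilon>. \<epsilon> ^ Suc k) (\<lambda>\<epsilon> x. S (Suc k) \<epsilon> x - S k \<epsilon> x)"
    using fm bdd_derivs_Suc unfolding S_def by blast
  then show ?case using G' eqS by (simp add: S'_def m_def[symmetric])
qed

subsection \<open>Decay estimates\<close>

text \<open>Any rate \<open>a\<close> below \<open>2 * \<kappa>\<close> survives: the gap
  \<open>2 * \<kappa> - a\<close> pays for the linear term by completing the square. Working with
  the squared norm avoids differentiating the norm at zeros of \<open>z\<close>.\<close>

lemma exponential_decay:
  fixes z :: "real \<Rightarrow> 'b::real_inner"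
  assumes z: "\<And>t. t \<ge> 0 \<Longrightarrow> (z has_vector_derivative z' t) (at t within {0..})"
    and le: "\<And>t. t \<ge> 0 \<Longrightarrow> z t \<bullet> z' t \<le> - \<kappa> * (norm (z t))\<^sup>2 + P * norm (z t)"
    and a: "0 < a" "a < 2 * \<kappa>" and t: "0 \<le> t"
  shows "(norm (z t))\<^sup>2 \<le> exp (- a * t) * (norm (z 0))\<^sup>2 + P\<^sup>2 / (a * (2 * \<kappa> - a))"
proof -
  \<comment> \<open>Chosen so that \<open>a * c\<close> is the constant term of the completed
    square; this makes \<phi> nonincreasing.\<close>
  define c where "c = P\<^sup>2 / (a * (2 * \<kappa> - a))"
  define \<phi> where "\<phi> = (\<lambda>t. exp (a * t) * (z t \<bullet> z t - c))"
  define \<phi>' where "\<phi>' = (\<lambda>t. exp (a * t) * (2 * (z t \<bullet> z' t) + a * (z t \<bullet> z t - c)))"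
  have "c \<ge> 0" using a by (simp add: c_def)
  have der: "(\<phi> has_derivative (\<lambda>h. \<phi>' s * h)) (at s within {0..t})" if "0 \<le> s" for s
  proof -
    have zs: "(z has_derivative (\<lambda>h. h *\<^sub>R z' s)) (at s within {0..t})"
      using has_vector_derivative_within_subset[OF z[OF that], of "{0..t}"]
      by (auto simp: has_vector_derivative_def)
    show ?thesis unfolding \<phi>_def \<phi>'_def
      by (rule has_derivative_eq_rhs, (rule derivative_eq_intros zs refl)+)
        (auto simp: algebra_simps inner_commute)
  qed
  have neg: "\<phi>' s \<le> 0" if "0 \<le> s" for s
  proof -
    let ?n = "norm (z s)" and ?d = "2 * \<kappa> - a"
    have "2 * (z s \<bullet> z' s) + a * (z s \<bullet> z s - c) \<le> 2 * (- \<kappa> * ?n\<^sup>2 + P * ?n) + a * (?n\<^sup>2 - c)"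
      using le[OF that] by (simp add: power2_norm_eq_inner)
    also have "\<dots> = - ((?d * ?n - P)\<^sup>2 / ?d)"
    proof -
      have "a * c = P\<^sup>2 / ?d" using a by (simp add: c_def)
      moreover have "(?d * ?n - P)\<^sup>2 / ?d = ?d * ?n\<^sup>2 - 2 * P * ?n + P\<^sup>2 / ?d"
      proof -
        have "(?d * ?n - P)\<^sup>2 = ?d * (?d * ?n\<^sup>2 - 2 * P * ?n) + P\<^sup>2"
          by (simp add: power2_eq_square algebra_simps)
        then show ?thesis using a by (simp add: add_divide_distrib)
      qed
      ultimately show ?thesis by (simp add: algebra_simps)
    qed
    also have "\<dots> \<le> 0" using a by simp
    finally show ?thesis by (simp add: \<phi>'_def mult_le_0_iff)
  qed
  obtain s where "s \<in> {0..t}" "\<phi> t - \<phi> 0 = \<phi>' s * (t - 0)"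
    using mvt_very_simple[OF t, of \<phi> "\<lambda>s h. \<phi>' s * h"] der by auto
  with mult_nonpos_nonneg[OF neg[of s] t] have "\<phi> t \<le> \<phi> 0" by simp
  then have "exp (a * t) * (z t \<bullet> z t - c) \<le> z 0 \<bullet> z 0" using \<open>c \<ge> 0\<close> by (simp add: \<phi>_def)
  from mult_left_mono[OF this, of "exp (- a * t)"]
  have "(exp (- a * t) * exp (a * t)) * (z t \<bullet> z t - c) \<le> exp (- a * t) * (z 0 \<bullet> z 0)"
    by (simp only: mult.assoc exp_ge_zero)
  then have "z t \<bullet> z t - c \<le> exp (- a * t) * (z 0 \<bullet> z 0)"
    by (simp add: mult_exp_exp)
  then show ?thesis by (simp add: power2_norm_eq_inner c_def)
qed

text \<open>The fine bound only helps when \<open>H\<close> is dominated by the contraction rate, that is for small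
  \<open>\<epsilon>\<close>. For the remaining \<open>\<epsilon>\<close>, bounded away from 0, the crude bound suffices because
  \<open>\<epsilon> ^ (2 * k)\<close> is then bounded below.\<close>

lemma tracking_estimate:
  fixes \<beta> A C\<^sub>1 H M :: real
  assumes A: "0 < A" "A < 2 * \<beta>" and H: "0 < H"
  shows "\<exists>C>0. \<forall>\<epsilon>\<in>{0<..1}. \<forall>(z :: real \<Rightarrow> 'b::real_inner) z'.
    (\<forall>t\<ge>0. (z has_vector_derivative z' t) (at t within {0..})) \<longrightarrow>
    (\<forall>t\<ge>0. z t \<bullet> z' t \<le> - (\<beta> / \<epsilon>) * (norm (z t))\<^sup>2 + (C\<^sub>1 * \<epsilon> ^ k + H * norm (z t)) * norm (z t)) \<longrightarrow>
    (\<forall>t\<ge>0. z t \<bullet> z' t \<le> - (\<beta> / \<epsilon>) * (norm (z t))\<^sup>2 + M * norm (z t)) \<longrightarrow>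
    (\<forall>t\<ge>0. (norm (z t))\<^sup>2 \<le> C * (\<epsilon> ^ (2 * k + 2) + exp (- (A / \<epsilon>) * t) * (norm (z 0))\<^sup>2))"
proof -
  define \<delta> where "\<delta> = 2 * \<beta> - A"
  have \<delta>: "0 < \<delta>" using A by (simp add: \<delta>_def)
  \<comment> \<open>Up to this threshold \<open>2 * H\<close> takes at most half of the gap
    \<delta>/\<epsilon>.\<close>
  define \<epsilon>\<^sub>1 where "\<epsilon>\<^sub>1 = \<delta> / (4 * H)"
  have \<epsilon>\<^sub>1: "0 < \<epsilon>\<^sub>1" using \<delta> H by (simp add: \<epsilon>\<^sub>1_def)
  \<comment> \<open>The 1 carries the initial term, the second summand comes from the fine bound
    with half the gap left, the third from the crude bound with the full gap.\<close>
  define C where "C = 1 + 2 * C\<^sub>1\<^sup>2 / (A * \<delta>) + M\<^sup>2 / (A * \<delta> * \<epsilon>\<^sub>1 ^ (2 * k))"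
  have terms: "0 \<le> 2 * C\<^sub>1\<^sup>2 / (A * \<delta>)" "0 \<le> M\<^sup>2 / (A * \<delta> * \<epsilon>\<^sub>1 ^ (2 * k))"
    using A \<delta> \<epsilon>\<^sub>1 by simp_all
  then have C: "1 \<le> C" "2 * C\<^sub>1\<^sup>2 / (A * \<delta>) \<le> C" "M\<^sup>2 / (A * \<delta> * \<epsilon>\<^sub>1 ^ (2 * k)) \<le> C"
    by (simp_all add: C_def)
  show ?thesis
  proof (intro exI[of _ C] conjI ballI allI impI)
    show "0 < C" using C(1) by simp
    fix \<epsilon> :: real and z z' :: "real \<Rightarrow> 'b" and t :: real
    assume "\<epsilon> \<in> {0<..1}" and t: "0 \<le> t"
      and z: "\<forall>t\<ge>0. (z has_vector_derivative z' t) (at t within {0..})"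
      and fine: "\<forall>t\<ge>0. z t \<bullet> z' t \<le> - (\<beta> / \<epsilon>) * (norm (z t))\<^sup>2 + (C\<^sub>1 * \<epsilon> ^ k + H * norm (z t)) * norm (z t)"
      and crude: "\<forall>t\<ge>0. z t \<bullet> z' t \<le> - (\<beta> / \<epsilon>) * (norm (z t))\<^sup>2 + M * norm (z t)"
    then have \<epsilon>: "0 < \<epsilon>" by simp
    have a: "0 < A / \<epsilon>" using A \<epsilon> by simp
    have "\<exists>c. (norm (z t))\<^sup>2 \<le> exp (- (A / \<epsilon>) * t) * (norm (z 0))\<^sup>2 + c \<and> c \<le> C * \<epsilon> ^ (2 * k + 2)"
    proof (cases "\<epsilon> \<le> \<epsilon>\<^sub>1")
      case True
      let ?\<kappa> = "\<beta> / \<epsilon> - H" and ?P = "C\<^sub>1 * \<epsilon> ^ k"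
      have "4 * H * \<epsilon> \<le> \<delta>" using True H by (simp add: \<epsilon>\<^sub>1_def field_simps)
      then have "2 * H \<le> \<delta> / (2 * \<epsilon>)" using \<epsilon> by (simp add: field_simps)
      moreover have "2 * ?\<kappa> - A / \<epsilon> = \<delta> / \<epsilon> - 2 * H" by (simp add: \<delta>_def diff_divide_distrib)
      moreover have "\<delta> / \<epsilon> = \<delta> / (2 * \<epsilon>) + \<delta> / (2 * \<epsilon>)" by simp
      ultimately have gap: "\<delta> / (2 * \<epsilon>) \<le> 2 * ?\<kappa> - A / \<epsilon>" by linarith
      have pos: "0 < \<delta> / (2 * \<epsilon>)" using \<delta> \<epsilon> by simp
      have "z s \<bullet> z' s \<le> - ?\<kappa> * (norm (z s))\<^sup>2 + ?P * norm (z s)" if "0 \<le> s" for s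
        using fine[rule_format, OF that] by (simp add: algebra_simps power2_eq_square)
      moreover have "A / \<epsilon> < 2 * ?\<kappa>" using gap pos by linarith
      ultimately have "(norm (z t))\<^sup>2 \<le> exp (- (A / \<epsilon>) * t) * (norm (z 0))\<^sup>2
          + ?P\<^sup>2 / (A / \<epsilon> * (2 * ?\<kappa> - A / \<epsilon>))"
        using z a t by (intro exponential_decay) auto
      moreover have "?P\<^sup>2 / (A / \<epsilon> * (2 * ?\<kappa> - A / \<epsilon>)) \<le> ?P\<^sup>2 / (A / \<epsilon> * (\<delta> / (2 * \<epsilon>)))"
        using gap pos a by (intro divide_left_mono mult_left_mono mult_pos_pos) auto
      moreover have "?P\<^sup>2 / (A / \<epsilon> * (\<delta> / (2 * \<epsilon>))) = 2 * C\<^sub>1\<^sup>2 / (A * \<delta>) * \<epsilon> ^ (2 * k + 2)"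
        using \<epsilon> A \<delta> power_even_eq[of \<epsilon> k]
        by (simp add: power_add power2_eq_square[of \<epsilon>] field_simps)
      moreover have "2 * C\<^sub>1\<^sup>2 / (A * \<delta>) * \<epsilon> ^ (2 * k + 2) \<le> C * \<epsilon> ^ (2 * k + 2)"
        using C(2) \<epsilon> by (intro mult_right_mono) auto
      ultimately show ?thesis by (intro exI[of _ "?P\<^sup>2 / (A / \<epsilon> * (2 * ?\<kappa> - A / \<epsilon>))"]) linarith
    next
      case False
      have gap: "2 * (\<beta> / \<epsilon>) - A / \<epsilon> = \<delta> / \<epsilon>" by (simp add: \<delta>_def diff_divide_distrib)
      have "A / \<epsilon> < 2 * (\<beta> / \<epsilon>)" using A \<epsilon> by (simp add: divide_strict_right_mono)
      then have "(norm (z t))\<^sup>2 \<le> exp (- (A / \<epsilon>) * t) * (norm (z 0))\<^sup>2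
          + M\<^sup>2 / (A / \<epsilon> * (2 * (\<beta> / \<epsilon>) - A / \<epsilon>))"
        using z a t crude by (intro exponential_decay) auto
      moreover have "M\<^sup>2 / (A / \<epsilon> * (\<delta> / \<epsilon>)) = M\<^sup>2 / (A * \<delta> * \<epsilon> ^ (2 * k)) * \<epsilon> ^ (2 * k + 2)"
        using \<epsilon> by (simp add: power_add power2_eq_square field_simps)
      moreover have "M\<^sup>2 / (A * \<delta> * \<epsilon> ^ (2 * k)) \<le> M\<^sup>2 / (A * \<delta> * \<epsilon>\<^sub>1 ^ (2 * k))"
        using False A \<delta> \<epsilon>\<^sub>1 \<epsilon> by (intro divide_left_mono mult_left_mono power_mono mult_pos_pos) auto
      then have "M\<^sup>2 / (A * \<delta> * \<epsilon> ^ (2 * k)) * \<epsilon> ^ (2 * k + 2) \<le> C * \<epsilon> ^ (2 * k + 2)"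
        using C(3) \<epsilon> by (intro mult_right_mono) auto
      ultimately show ?thesis unfolding gap by (intro exI[of _ "M\<^sup>2 / (A / \<epsilon> * (\<delta> / \<epsilon>))"]) linarith
    qed
    then obtain c where "(norm (z t))\<^sup>2 \<le> exp (- (A / \<epsilon>) * t) * (norm (z 0))\<^sup>2 + c"
      "c \<le> C * \<epsilon> ^ (2 * k + 2)" by blast
    moreover have "1 * (exp (- (A / \<epsilon>) * t) * (norm (z 0))\<^sup>2) \<le> C * (exp (- (A / \<epsilon>) * t) * (norm (z 0))\<^sup>2)"
      using C(1) by (intro mult_right_mono) auto
    ultimately show "(norm (z t))\<^sup>2 \<le> C * (\<epsilon> ^ (2 * k + 2) + exp (- (A / \<epsilon>) * t) * (norm (z 0))\<^sup>2)"
      unfolding distrib_left by linarith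
  qed
qed

lemma eventually_exp_decay_le:
  fixes c b d :: real
  assumes "0 < c" "0 < d" "0 \<le> b"
  shows "\<forall>\<^sub>F t in at_top. exp (- c * t) * b \<le> d"
  using eventually_ge_at_top[of "b / (c * d)"]
proof eventually_elim
  case (elim t)
  have "b \<le> d * (c * t)" using elim assms by (simp add: field_simps)
  also have "\<dots> \<le> d * exp (c * t)"
    using assms exp_ge_add_one_self[of "c * t"] by (intro mult_left_mono) linarith+
  finally show ?case by (simp add: exp_minus field_simps)
qed

section \<open>Trajectories compared with the k-th slow manifold\<close>

theorem theorem3p9:
  fixes f :: "(real ^ 'nx) \<times> (real ^ 'ny) \<Rightarrow> real ^ 'nx"
    and g :: "(real ^ 'nx) \<times> (real ^ 'ny) \<Rightarrow> real ^ 'ny"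
    and \<gamma> :: "real ^ 'nx \<Rightarrow> real ^ 'ny"
    and \<Gamma> :: "nat \<Rightarrow> real ^ 'nx \<Rightarrow> real \<Rightarrow> real ^ 'ny"
    and K :: nat and \<beta> \<epsilon>\<^sub>0 :: real
  assumes "K \<ge> 1"
    and "0 < \<epsilon>\<^sub>0" and "\<epsilon>\<^sub>0 < 1"
    and "Ck K f" and "sobolev_inf_norm K f < \<infinity>"
    and "Ck (K + 1) g" and "grad_sobolev_inf_norm K g < \<infinity>"
    and "\<forall>x. g (x, \<gamma> x) = 0"
    and "0 < \<beta>"
    and "\<forall>x y y'. (g (x, y) - g (x, y')) \<bullet> (y - y') \<le> - \<beta> * (norm (y - y'))\<^sup>2"
    and "\<forall>\<epsilon>\<in>{0<..\<epsilon>\<^sub>0}. \<forall>x. \<Gamma> 0 x \<epsilon> = \<gamma> x"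
    and "\<forall>\<epsilon>\<in>{0<..\<epsilon>\<^sub>0}. \<forall>k x. g (x, \<Gamma> (Suc k) x \<epsilon>) =
           \<epsilon> *\<^sub>R (jacobian (\<lambda>\<xi>. \<Gamma> k \<xi> \<epsilon>) (at x) *v f (x, \<Gamma> k x \<epsilon>))"
  shows "\<forall>k\<le>K.
    (\<forall>A\<in>{0<..<2 * \<beta>}. \<exists>C>0. \<forall>\<epsilon>\<in>{0<..\<epsilon>\<^sub>0}. \<forall>x\<^sub>0 y\<^sub>0 x y.
       slow_fast_solution f g \<epsilon> x\<^sub>0 y\<^sub>0 x y \<longrightarrow>
       (\<forall>t\<ge>0. (norm (y t - \<Gamma> k (x t) \<epsilon>))\<^sup>2 \<le>
          C * (\<epsilon> ^ (2 * k + 2) + exp (- (A / \<epsilon>) * t) * (norm (y 0 - \<Gamma> k (x 0) \<epsilon>))\<^sup>2))) \<and>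
    (\<exists>C>0. \<forall>\<epsilon>\<in>{0<..\<epsilon>\<^sub>0}. \<forall>x\<^sub>0 y\<^sub>0 x y.
       slow_fast_solution f g \<epsilon> x\<^sub>0 y\<^sub>0 x y \<longrightarrow>
       (\<forall>\<^sub>F t in at_top. norm (y t - \<Gamma> k (x t) \<epsilon>) \<le> C * \<epsilon> ^ (k + 1)))"
proof (intro allI impI)
  fix k assume "k \<le> K"
  define I where "I = {0<..\<epsilon>\<^sub>0}"
  have I: "I \<subseteq> {0..1}" "\<epsilon>\<^sub>0 \<in> I" using assms(2,3) by (auto simp: I_def)
  define G where "G = (\<lambda>k \<epsilon> x. \<Gamma> k x \<epsilon>)"
  define S where "S = (\<lambda>k \<epsilon> x. frechet_derivative (G k \<epsilon>) (at x) (f (x, G k \<epsilon> x)))"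
  define S' where "S' = (\<lambda>k \<epsilon> x. case k of 0 \<Rightarrow> 0 | Suc l \<Rightarrow> S l \<epsilon> x)"
  have mono: "(g (x, y) - g (x, y')) \<bullet> (y - y') \<le> - \<beta> * (norm (y - y'))\<^sup>2" for x y y'
    using assms(10) by blast
  have f: "bdd_derivs K I (\<lambda>_. 1) (\<lambda>_. f)" by (rule bdd_derivs_sobolev[OF assms(4,5)])
  have g: "bdd_grad K I (\<lambda>_. 1) (\<lambda>_. g)" by (rule bdd_grad_sobolev) (use assms(6,7) in simp_all)
  have G0: "g (x, G 0 \<epsilon> x) = 0" if "\<epsilon> \<in> I" for \<epsilon> x
    using assms(8,11) that by (simp add: G_def I_def)
  have GSuc: "g (x, G (Suc l) \<epsilon> x) = \<epsilon> *\<^sub>R frechet_derivative (G l \<epsilon>) (at x) (f (x, G l \<epsilon> x))"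
    if "\<epsilon> \<in> I" and "\<And>x. G l \<epsilon> differentiable (at x)" for l \<epsilon> x
  proof -
    \<comment> \<open>The matrix \<open>jacobian\<close> represents the derivative only where the
      map is differentiable, hence the premise.\<close>
    have "frechet_derivative (G l \<epsilon>) (at x) = (\<lambda>h. jacobian (G l \<epsilon>) (at x) *v h)"
      using that(2)[of x] unfolding jacobian_works by (rule frechet_derivative_at[symmetric])
    then show ?thesis using assms(12) that(1) by (simp add: G_def I_def)
  qed
  have "bdd_grad (K - k) I (\<lambda>_. 1) (G k) \<and>
    bdd_derivs (K - k) I (\<lambda>\<epsilon>. \<epsilon> ^ k) (\<lambda>\<epsilon> x. S k \<epsilon> x - S' k \<epsilon> x) \<and>
    (\<forall>\<epsilon>\<in>I. \<forall>x. g (x, G k \<epsilon> x) = \<epsilon> *\<^sub>R S' k \<epsilon> x)"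
    unfolding S'_def unfolding S_def
    by (rule slow_manifold_hierarchy) (fact assms(9) mono f g I(1) G0 GSuc \<open>k \<le> K\<close>)+
  then have bG: "bdd_grad (K - k) I (\<lambda>_. 1) (G k)"
    and R: "unif_bdd I (\<lambda>\<epsilon>. \<epsilon> ^ k) (\<lambda>\<epsilon> x. S k \<epsilon> x - S' k \<epsilon> x)"
    and eq: "\<And>\<epsilon> x. \<epsilon> \<in> I \<Longrightarrow> g (x, G k \<epsilon> x) = \<epsilon> *\<^sub>R S' k \<epsilon> x"
    using bdd_derivs_unif_bdd by blast+
  obtain L where L: "L \<ge> 0" "\<And>\<epsilon> x v. \<epsilon> \<in> I \<Longrightarrow> norm (frechet_derivative (G k \<epsilon>) (at x) v) \<le> L * norm v"
    using bdd_grad_frechet_bound[OF bG] by blast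
  obtain F where F: "\<And>p. norm (f p) \<le> F"
    using bdd_derivs_unif_bdd[OF f] I(2) unfolding unif_bdd_def by auto
  \<comment> \<open>With \<open>K \<ge> 1\<close> the gradient of \<open>f\<close> is bounded, so
    \<open>f\<close> is Lipschitz, also in the last case k = K.\<close>
  have "bdd_derivs (Suc 0) I (\<lambda>_. 1) (\<lambda>_. f)" by (rule bdd_derivs_le[OF f]) (use assms(1) in simp)
  then have "bdd_grad 0 I (\<lambda>_. 1) (\<lambda>_. f)" unfolding bdd_derivs_Suc by blast
  then obtain L' where L': "L' \<ge> 0" "\<And>p q. norm (f p - f q) \<le> L' * norm (p - q)"
    using bdd_grad_lipschitz I(2) by blast
  obtain C\<^sub>0 where C\<^sub>0: "\<And>\<epsilon> x. \<epsilon> \<in> I \<Longrightarrow> norm (S k \<epsilon> x - S' k \<epsilon> x) \<le> C\<^sub>0 * \<epsilon> ^ k"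
    using R unfolding unif_bdd_def by blast
  define C\<^sub>1 where "C\<^sub>1 = \<bar>C\<^sub>0\<bar>"
  have C\<^sub>1: "norm (S k \<epsilon> x - S' k \<epsilon> x) \<le> C\<^sub>1 * \<epsilon> ^ k" "C\<^sub>1 * \<epsilon> ^ k \<le> C\<^sub>1" if "\<epsilon> \<in> I" for \<epsilon> x
  proof -
    have \<epsilon>: "0 \<le> \<epsilon>" "\<epsilon> \<le> 1" using that I(1) by auto
    have "C\<^sub>0 * \<epsilon> ^ k \<le> C\<^sub>1 * \<epsilon> ^ k" using \<epsilon> by (intro mult_right_mono) (auto simp: C\<^sub>1_def)
    then show "norm (S k \<epsilon> x - S' k \<epsilon> x) \<le> C\<^sub>1 * \<epsilon> ^ k" using C\<^sub>0[OF that, of x] by linarith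
    show "C\<^sub>1 * \<epsilon> ^ k \<le> C\<^sub>1" using mult_left_mono[OF power_le_one[OF \<epsilon>, of k], of C\<^sub>1] by (simp add: C\<^sub>1_def)
  qed
  \<comment> \<open>The 1 makes \<open>H\<close> strictly positive, as
    \<open>tracking_estimate\<close> requires. In \<open>M\<close> the two transport terms are
    bounded separately by \<open>L * F\<close>, without using that \<open>z\<close> is
    small.\<close>
  define H where "H = L * L' + 1"
  define M where "M = C\<^sub>1 + 2 * (L * F)"
  have "0 < H" using L(1) L'(1) by (simp add: H_def add_nonneg_pos)
  have bound: "\<exists>C>0. \<forall>\<epsilon>\<in>{0<..\<epsilon>\<^sub>0}. \<forall>x\<^sub>0 y\<^sub>0 x y. slow_fast_solution f g \<epsilon> x\<^sub>0 y\<^sub>0 x y \<longrightarrow>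
       (\<forall>t\<ge>0. (norm (y t - \<Gamma> k (x t) \<epsilon>))\<^sup>2 \<le>
          C * (\<epsilon> ^ (2 * k + 2) + exp (- (A / \<epsilon>) * t) * (norm (y 0 - \<Gamma> k (x 0) \<epsilon>))\<^sup>2))"
    if A: "A \<in> {0<..<2 * \<beta>}" for A
  proof -
    have "0 < A" "A < 2 * \<beta>" using A by auto
    from tracking_estimate[OF this \<open>0 < H\<close>, where ?C\<^sub>1.0 = C\<^sub>1 and M = M and k = k and 'b = "real ^ 'ny"]
    obtain C where "C > 0" and C: "\<And>\<epsilon> (z :: real \<Rightarrow> real ^ 'ny) z' t. \<epsilon> \<in> {0<..1} \<Longrightarrow>
      (\<forall>t\<ge>0. (z has_vector_derivative z' t) (at t within {0..})) \<Longrightarrow>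
      (\<forall>t\<ge>0. z t \<bullet> z' t \<le> - (\<beta> / \<epsilon>) * (norm (z t))\<^sup>2 + (C\<^sub>1 * \<epsilon> ^ k + H * norm (z t)) * norm (z t)) \<Longrightarrow>
      (\<forall>t\<ge>0. z t \<bullet> z' t \<le> - (\<beta> / \<epsilon>) * (norm (z t))\<^sup>2 + M * norm (z t)) \<Longrightarrow> 0 \<le> t \<Longrightarrow>
      (norm (z t))\<^sup>2 \<le> C * (\<epsilon> ^ (2 * k + 2) + exp (- (A / \<epsilon>) * t) * (norm (z 0))\<^sup>2)"
      by metis
    show ?thesis
    proof (intro exI[of _ C] conjI ballI allI impI)
      show "C > 0" by fact
      fix \<epsilon> x\<^sub>0 y\<^sub>0 x y and t :: real
      assume "\<epsilon> \<in> {0<..\<epsilon>\<^sub>0}" and sol: "slow_fast_solution f g \<epsilon> x\<^sub>0 y\<^sub>0 x y" and t: "0 \<le> t"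
      then have \<epsilon>: "\<epsilon> \<in> I" "0 < \<epsilon>" "\<epsilon> \<in> {0<..1}" using I(1) by (auto simp: I_def)
      define z where "z = (\<lambda>t. y t - G k \<epsilon> (x t))"
      define D where "D = (\<lambda>t. frechet_derivative (G k \<epsilon>) (at (x t)))"
      define z' where "z' = (\<lambda>t. (1 / \<epsilon>) *\<^sub>R g (x t, y t) - D t (f (x t, y t)))"
      have dG: "(G k \<epsilon> has_derivative D t) (at (x t))" for t
        using bG \<epsilon>(1) frechet_derivative_works unfolding bdd_grad_def D_def by blast
      have der: "(z has_vector_derivative z' t) (at t within {0..})" if "t \<ge> 0" for t
      proof -
        have x: "(x has_vector_derivative f (x t, y t)) (at t within {0..})"
          and y: "(y has_vector_derivative (1 / \<epsilon>) *\<^sub>R g (x t, y t)) (at t within {0..})"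
          using sol that unfolding slow_fast_solution_def by blast+
        from vector_derivative_diff_chain_within[OF x has_derivative_at_withinI[OF dG]]
        have "((\<lambda>t. G k \<epsilon> (x t)) has_vector_derivative D t (f (x t, y t))) (at t within {0..})"
          by (simp add: o_def)
        from has_vector_derivative_diff[OF y this] show ?thesis unfolding z_def z'_def .
      qed
      \<comment> \<open>All of \<open>z'\<close> except the contracting difference of
        \<open>g\<close>: on the manifold, g/\<epsilon> equals \<open>S' k\<close>, so adding and
        subtracting it leaves \<open>e\<close>.\<close>
      define e where "e = (\<lambda>t. S' k \<epsilon> (x t) - D t (f (x t, y t)))"
      have zz': "z t \<bullet> z' t \<le> - (\<beta> / \<epsilon>) * (norm (z t))\<^sup>2 + norm (e t) * norm (z t)" for t
      proof -
        have "z' t = (1 / \<epsilon>) *\<^sub>R (g (x t, y t) - g (x t, G k \<epsilon> (x t))) + e t"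
          using \<epsilon>(2) by (simp add: z'_def e_def eq[OF \<epsilon>(1)] scaleR_diff_right)
        then have "z t \<bullet> z' t = (1 / \<epsilon>) * ((g (x t, y t) - g (x t, G k \<epsilon> (x t))) \<bullet> z t) + e t \<bullet> z t"
          by (simp add: inner_add_right inner_commute)
        also have "\<dots> \<le> (1 / \<epsilon>) * (- \<beta> * (norm (z t))\<^sup>2) + norm (e t) * norm (z t)"
          using mono[of "x t" "y t" "G k \<epsilon> (x t)"] \<epsilon>(2) norm_cauchy_schwarz[of "e t" "z t"]
          by (intro add_mono mult_left_mono) (simp_all add: z_def)
        finally show ?thesis by simp
      qed
      have e: "e t = - (S k \<epsilon> (x t) - S' k \<epsilon> (x t)) + (D t (f (x t, G k \<epsilon> (x t))) - D t (f (x t, y t)))" for t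
        by (simp add: e_def S_def D_def)
      have S_bound: "norm (- (S k \<epsilon> (x t) - S' k \<epsilon> (x t))) \<le> C\<^sub>1 * \<epsilon> ^ k" for t
        unfolding norm_minus_cancel by (rule C\<^sub>1(1)[OF \<epsilon>(1)])
      have fine: "norm (e t) \<le> C\<^sub>1 * \<epsilon> ^ k + H * norm (z t)" for t
      proof -
        have "norm (D t (f (x t, G k \<epsilon> (x t))) - D t (f (x t, y t)))
            = norm (D t (f (x t, G k \<epsilon> (x t)) - f (x t, y t)))"
          using linear_diff[OF has_derivative_linear[OF dG]] by metis
        also have "\<dots> \<le> L * norm (f (x t, G k \<epsilon> (x t)) - f (x t, y t))"
          unfolding D_def by (rule L(2)[OF \<epsilon>(1)])
        also have "\<dots> \<le> L * (L' * norm ((x t, G k \<epsilon> (x t)) - (x t, y t)))"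
          by (intro mult_left_mono L'(2) L(1))
        also have "norm ((x t, G k \<epsilon> (x t)) - (x t, y t)) = norm (z t)"
          by (simp add: norm_Pair z_def norm_minus_commute)
        also have "L * (L' * norm (z t)) \<le> H * norm (z t)" by (simp add: H_def algebra_simps)
        finally have "norm (D t (f (x t, G k \<epsilon> (x t))) - D t (f (x t, y t))) \<le> H * norm (z t)" .
        then show ?thesis unfolding e
          by (rule order_trans[OF norm_triangle_ineq add_mono[OF S_bound]])
      qed
      have crude: "norm (e t) \<le> M" for t
      proof -
        have D: "norm (D t (f p)) \<le> L * F" for p
          using L(2)[OF \<epsilon>(1), of "x t" "f p"] mult_left_mono[OF F[of p] L(1)] by (simp add: D_def)
        have "norm (- (S k \<epsilon> (x t) - S' k \<epsilon> (x t))) \<le> C\<^sub>1"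
          by (rule order_trans[OF S_bound C\<^sub>1(2)[OF \<epsilon>(1)]])
        moreover have "norm (D t (f (x t, G k \<epsilon> (x t))) - D t (f (x t, y t))) \<le> 2 * (L * F)"
          unfolding mult_2 by (rule order_trans[OF norm_triangle_ineq4 add_mono[OF D D]])
        ultimately show ?thesis unfolding e M_def
          by (rule order_trans[OF norm_triangle_ineq add_mono])
      qed
      have "(norm (z t))\<^sup>2 \<le> C * (\<epsilon> ^ (2 * k + 2) + exp (- (A / \<epsilon>) * t) * (norm (z 0))\<^sup>2)"
      proof (rule C[OF \<epsilon>(3), where z' = z'])
        show "\<forall>t\<ge>0. z t \<bullet> z' t \<le> - (\<beta> / \<epsilon>) * (norm (z t))\<^sup>2 + (C\<^sub>1 * \<epsilon> ^ k + H * norm (z t)) * norm (z t)"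
          by (intro allI impI order_trans[OF zz'] add_left_mono mult_right_mono fine norm_ge_zero)
        show "\<forall>t\<ge>0. z t \<bullet> z' t \<le> - (\<beta> / \<epsilon>) * (norm (z t))\<^sup>2 + M * norm (z t)"
          by (intro allI impI order_trans[OF zz'] add_left_mono mult_right_mono crude norm_ge_zero)
      qed (use der t in auto)
      then show "(norm (y t - \<Gamma> k (x t) \<epsilon>))\<^sup>2 \<le>
          C * (\<epsilon> ^ (2 * k + 2) + exp (- (A / \<epsilon>) * t) * (norm (y 0 - \<Gamma> k (x 0) \<epsilon>))\<^sup>2)"
        by (simp only: z_def G_def)
    qed
  qed
  show "(\<forall>A\<in>{0<..<2 * \<beta>}. \<exists>C>0. \<forall>\<epsilon>\<in>{0<..\<epsilon>\<^sub>0}. \<forall>x\<^sub>0 y\<^sub>0 x y.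
       slow_fast_solution f g \<epsilon> x\<^sub>0 y\<^sub>0 x y \<longrightarrow>
       (\<forall>t\<ge>0. (norm (y t - \<Gamma> k (x t) \<epsilon>))\<^sup>2 \<le>
          C * (\<epsilon> ^ (2 * k + 2) + exp (- (A / \<epsilon>) * t) * (norm (y 0 - \<Gamma> k (x 0) \<epsilon>))\<^sup>2))) \<and>
    (\<exists>C>0. \<forall>\<epsilon>\<in>{0<..\<epsilon>\<^sub>0}. \<forall>x\<^sub>0 y\<^sub>0 x y.
       slow_fast_solution f g \<epsilon> x\<^sub>0 y\<^sub>0 x y \<longrightarrow>
       (\<forall>\<^sub>F t in at_top. norm (y t - \<Gamma> k (x t) \<epsilon>) \<le> C * \<epsilon> ^ (k + 1)))"
  proof (intro conjI ballI)
    \<comment> \<open>Any admissible rate serves for the long-time statement; the choice here is A =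
      \<beta>.\<close>
    obtain C where "C > 0" and C: "\<And>\<epsilon> x\<^sub>0 y\<^sub>0 x y t. \<epsilon> \<in> {0<..\<epsilon>\<^sub>0} \<Longrightarrow>
        slow_fast_solution f g \<epsilon> x\<^sub>0 y\<^sub>0 x y \<Longrightarrow> 0 \<le> t \<Longrightarrow> (norm (y t - \<Gamma> k (x t) \<epsilon>))\<^sup>2 \<le>
          C * (\<epsilon> ^ (2 * k + 2) + exp (- (\<beta> / \<epsilon>) * t) * (norm (y 0 - \<Gamma> k (x 0) \<epsilon>))\<^sup>2)"
      using bound[of \<beta>] assms(9) by auto
    show "\<exists>C>0. \<forall>\<epsilon>\<in>{0<..\<epsilon>\<^sub>0}. \<forall>x\<^sub>0 y\<^sub>0 x y. slow_fast_solution f g \<epsilon> x\<^sub>0 y\<^sub>0 x y \<longrightarrow>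
       (\<forall>\<^sub>F t in at_top. norm (y t - \<Gamma> k (x t) \<epsilon>) \<le> C * \<epsilon> ^ (k + 1))"
    proof (intro exI[of _ "sqrt (2 * C)"] conjI ballI allI impI)
      show "0 < sqrt (2 * C)" using \<open>C > 0\<close> by simp
      fix \<epsilon> x\<^sub>0 y\<^sub>0 x y
      assume \<epsilon>: "\<epsilon> \<in> {0<..\<epsilon>\<^sub>0}" and sol: "slow_fast_solution f g \<epsilon> x\<^sub>0 y\<^sub>0 x y"
      \<comment> \<open>The time from which this holds depends on \<epsilon> and on the initial
        deviation, the constant does not. From then on both terms are at most \<epsilon>^(2k+2), the
        origin of the factor 2 in \<open>sqrt (2 * C)\<close>.\<close>
      have "\<forall>\<^sub>F t in at_top. exp (- (\<beta> / \<epsilon>) * t) * (norm (y 0 - \<Gamma> k (x 0) \<epsilon>))\<^sup>2 \<le> \<epsilon> ^ (2 * k + 2)"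
        by (rule eventually_exp_decay_le) (use \<epsilon> assms(9) in auto)
      then show "\<forall>\<^sub>F t in at_top. norm (y t - \<Gamma> k (x t) \<epsilon>) \<le> sqrt (2 * C) * \<epsilon> ^ (k + 1)"
        using eventually_ge_at_top[of 0]
      proof eventually_elim
        case (elim t)
        have "(norm (y t - \<Gamma> k (x t) \<epsilon>))\<^sup>2 \<le> C * (\<epsilon> ^ (2 * k + 2) + \<epsilon> ^ (2 * k + 2))"
          using mult_left_mono[OF add_left_mono[OF elim(1)], of C "\<epsilon> ^ (2 * k + 2)"] \<open>C > 0\<close>
          by (intro order_trans[OF C[OF \<epsilon> sol elim(2)]]) simp
        also have "\<dots> = (sqrt (2 * C) * \<epsilon> ^ (k + 1))\<^sup>2"
          using \<open>C > 0\<close> power_even_eq[of \<epsilon> "k + 1"] by (simp add: power_mult_distrib)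
        finally show ?case by (rule power2_le_imp_le) (use \<epsilon> \<open>C > 0\<close> in auto)
      qed
    qed
  qed (rule bound)
qed

end
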